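(* Let $d\geqslant 2$ and let $\alpha=(\alpha_1,\ldots,\alpha_d)\in\Lambda^{d}$, where $\Lambda^d\subseteq\mathbb{R}^d$ is the set of non-singular frequencies. Then for Lebesgue almost every $\gamma\in\mathbb{R}^d$, $$\liminf_{n\to\infty}\; n^{1/d}\min_{\substack{m=(m_1,\ldots,m_d)\in\mathbb{Z}^d\\ \gcd(n,m_1,\ldots,m_d)=1}}\|\gamma-n\alpha+m\|_\infty=0,$$ where $n$ ranges over the positive integers.
   Context: $\|\cdot\|_\infty$ is the sup norm on $\mathbb{R}^d$. For $x\in\mathbb{R}^d$, define $\|x\|_{\mathbb{T}^d,\infty}=\min_{k\in\mathbb{Z}^d}\|x-k\|_\infty$. The non-singular frequency set $\Lambda^d\subseteq\mathbb{R}^d$ is the set of all $\alpha=(\alpha_1,\ldots,\alpha_d)\in\mathbb{R}^d$ such that $1,\alpha_1,\ldots,\alpha_d$ are linearly independent over $\mathbb{Q}$ and there exist $c_0>0$ and a sequence of positive integers $N_j\to\infty$ such that, for every $j$, $$\min_{1\leqslant n\leqslant N_j}\|n\alpha\|_{\mathbb{T}^d,\infty}\geqslant c_0N_j^{-1/d}.$$ *)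

theory Defs
  imports "HOL-Analysis.Analysis"
begin

text \<open>The ambient space is \<open>real ^ 'd\<close> with \<open>d = CARD('d)\<close>; its sup norm is the library's
  \<^const>\<open>infnorm\<close>. A point of the integer lattice is a vector \<open>m :: int ^ 'd\<close>.\<close>

definition real_vec :: "int ^ 'd \<Rightarrow> real ^ 'd" where
  "real_vec m = (\<chi> i. of_int (m $ i))"

lemma finite_lattice_points_infnorm:
  fixes x :: "real ^ 'd"
  shows "finite {m :: int ^ 'd. infnorm (x + real_vec m) \<le> r}"
proof -
  define L where "L = (\<Sum>i\<in>UNIV. \<bar>x $ i\<bar>)"
  have L: "\<bar>x $ i\<bar> \<le> L" for i
    unfolding L_def by (rule member_le_sum) auto
  let ?B = "{- \<lceil>r + L\<rceil>..\<lceil>r + L\<rceil>}"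
  have "{m. infnorm (x + real_vec m) \<le> r} \<subseteq> {m :: int ^ 'd. \<forall>i. m $ i \<in> ?B}"
  proof (intro subsetI CollectI allI)
    fix m :: "int ^ 'd" and i
    assume "m \<in> {m. infnorm (x + real_vec m) \<le> r}"
    then have "\<bar>x $ i + of_int (m $ i)\<bar> \<le> r"
      using component_le_infnorm_cart[of "x + real_vec m" i] by (simp add: real_vec_def)
    then have "\<bar>of_int (m $ i) :: real\<bar> \<le> r + L" using L[of i] by linarith
    then show "m $ i \<in> ?B" by (simp add: abs_le_iff) linarith
  qed
  moreover have "finite {m :: int ^ 'd. \<forall>i. m $ i \<in> ?B}"
  proof (rule finite_subset)
    show "{m :: int ^ 'd. \<forall>i. m $ i \<in> ?B} \<subseteq> vec_lambda ` (PiE UNIV (\<lambda>_. ?B))"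
    proof
      fix m :: "int ^ 'd"
      assume "m \<in> {m. \<forall>i. m $ i \<in> ?B}"
      then have "vec_nth m \<in> PiE UNIV (\<lambda>_. ?B)" by (simp only: PiE_UNIV_domain Pi_iff mem_Collect_eq) blast
      then have "vec_lambda (vec_nth m) \<in> vec_lambda ` (PiE UNIV (\<lambda>_. ?B))" by (rule imageI)
      then show "m \<in> vec_lambda ` (PiE UNIV (\<lambda>_. ?B))" by (simp only: vec_nth_inverse)
    qed
    show "finite (vec_lambda ` (PiE (UNIV :: 'd set) (\<lambda>_. ?B)))"
      by (intro finite_imageI finite_PiE) auto
  qed
  ultimately show ?thesis by (rule finite_subset)
qed

lemma lattice_Inf_attained:
  fixes x :: "real ^ 'd"
  assumes "M \<noteq> {}"
  shows "\<exists>m\<in>M. (INF m\<in>M. infnorm (x + real_vec m)) = infnorm (x + real_vec m)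
           \<and> (\<forall>m'\<in>M. infnorm (x + real_vec m) \<le> infnorm (x + real_vec m'))"
proof -
  let ?f = "\<lambda>m. infnorm (x + real_vec m)"
  obtain a where a: "a \<in> M" using assms by blast
  let ?S = "{m \<in> M. ?f m \<le> ?f a}"
  have fin: "finite ?S"
    by (rule finite_subset[OF _ finite_lattice_points_infnorm[of x "?f a"]]) auto
  have ne: "?S \<noteq> {}" using a by blast
  define m where "m = arg_min_on ?f ?S"
  have m: "m \<in> ?S" "\<And>m'. m' \<in> ?S \<Longrightarrow> ?f m \<le> ?f m'"
    unfolding m_def by (rule arg_min_if_finite(1)[OF fin ne]) (rule arg_min_least[OF fin ne])
  have le: "?f m \<le> ?f m'" if "m' \<in> M" for m'
    using m that by (cases "?f m' \<le> ?f a") auto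
  have "(INF m\<in>M. ?f m) = ?f m"
    by (rule cInf_eq_minimum) (use m le in auto)
  then show ?thesis using m le by auto
qed

definition torus_norm :: "real ^ 'd \<Rightarrow> real" where
  "torus_norm x = (INF k :: int ^ 'd. infnorm (x - real_vec k))"

text \<open>The infimum is the minimum of the usual definition.\<close>

lemma torus_norm_attained:
  fixes x :: "real ^ 'd"
  shows "\<exists>k. torus_norm x = infnorm (x - real_vec k)
           \<and> (\<forall>k'. infnorm (x - real_vec k) \<le> infnorm (x - real_vec k'))"
proof -
  have minus: "x - real_vec k = x + real_vec (- k)" for k
    by (simp add: real_vec_def vec_eq_iff)
  obtain m where m: "\<And>m'. infnorm (x + real_vec m) \<le> infnorm (x + real_vec m')"
    using lattice_Inf_attained[of UNIV x] by auto
  have min: "infnorm (x - real_vec (- m)) \<le> infnorm (x - real_vec k')" for k'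
    unfolding minus minus_minus by (rule m)
  have "torus_norm x = infnorm (x - real_vec (- m))"
    unfolding torus_norm_def by (rule cInf_eq_minimum) (use min in blast)+
  with min show ?thesis by blast
qed

text \<open>Linear independence of the family \<open>1, \<alpha>\<^sub>1, \<dots>, \<alpha>\<^sub>d\<close> over the rationals.\<close>

definition rat_independent_with_one :: "real ^ 'd \<Rightarrow> bool" where
  "rat_independent_with_one \<alpha> \<longleftrightarrow>
     (\<forall>(q0 :: rat) (q :: 'd \<Rightarrow> rat).
        of_rat q0 + (\<Sum>i\<in>UNIV. of_rat (q i) * \<alpha> $ i) = 0 \<longrightarrow> q0 = 0 \<and> (\<forall>i. q i = 0))"

definition nonsingular_frequencies :: "(real ^ 'd) set" where
  "nonsingular_frequencies =
     {\<alpha>. rat_independent_with_one \<alpha> \<and>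
        (\<exists>c0 > 0. \<exists>N :: nat \<Rightarrow> nat.
           (\<forall>j. N j > 0) \<and> filterlim N at_top sequentially \<and>
           (\<forall>j. Min ((\<lambda>n. torus_norm (real n *\<^sub>R \<alpha>)) ` {1..N j})
                  \<ge> c0 * real (N j) powr (- 1 / real CARD('d))))}"

definition coprime_lattice :: "nat \<Rightarrow> (int ^ 'd) set" where
  "coprime_lattice n = {m. Gcd (insert (int n) (range (\<lambda>i. m $ i))) = 1}"

definition coprime_min_dist :: "real ^ 'd \<Rightarrow> real ^ 'd \<Rightarrow> nat \<Rightarrow> real" where
  "coprime_min_dist \<gamma> \<alpha> n =
     (INF m \<in> coprime_lattice n. infnorm (\<gamma> - real n *\<^sub>R \<alpha> + real_vec m))"

text \<open>Again the infimum is a minimum, over a nonempty set.\<close>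

lemma coprime_min_dist_attained:
  fixes \<gamma> \<alpha> :: "real ^ 'd"
  shows "\<exists>m\<in>coprime_lattice n. coprime_min_dist \<gamma> \<alpha> n = infnorm (\<gamma> - real n *\<^sub>R \<alpha> + real_vec m)
           \<and> (\<forall>m'\<in>coprime_lattice n. infnorm (\<gamma> - real n *\<^sub>R \<alpha> + real_vec m)
                                       \<le> infnorm (\<gamma> - real n *\<^sub>R \<alpha> + real_vec m'))"
proof -
  have "(\<chi> i. 1) \<in> (coprime_lattice n :: (int ^ 'd) set)"
    by (simp add: coprime_lattice_def)
  then show ?thesis
    unfolding coprime_min_dist_def by (intro lattice_Inf_attained) auto
qed

end

theory Submission
  imports Defs
begin

text \<open>
  Write \<open>Q\<close> for a cube of side \<open>1/M\<close>. Visits of \<open>n\<alpha>\<close> (\<open>n \<le> N\<close>) to \<open>Q\<close> modulo the lattice are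
  equidistributed: by Kronecker's theorem any two cubes of equal side are visited equally often up to
  a slight enlargement and a bounded error, and the \<open>M\<^sup>d\<close> translates tiling the torus
  receive \<open>N\<close> visits in total. A visit \<open>n\<alpha> - m \<in> Q\<close> with \<open>gcd(n, m) = k\<close> yields a visit of \<open>(n/k)\<alpha>\<close> to
  \<open>Q/k\<close>, so the non-coprime visits with \<open>2 \<le> k \<le> K\<close> number about
  \<open>N M\<^sup>-\<^sup>d \<Sum> k\<^sup>-\<^sup>d\<^sup>-\<^sup>1\<close>, a proper fraction of all visits. For \<open>k > K\<close> the \<open>c N\<^sup>-\<^sup>1\<^sup>/\<^sup>d\<close>-separation of
  the orbit along the non-singular subsequence of \<open>N\<close> bounds the visits to \<open>Q/k\<close>. Hence at
  least \<open>C N M\<^sup>-\<^sup>d\<close> visits are coprime, and the balls of radius \<open>e N\<^sup>-\<^sup>1\<^sup>/\<^sup>d\<close> around them are disjoint.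
  They fill a fixed fraction of each small cube, uniformly in the cube, so by Vitali's covering
  theorem almost every point lies in such balls with \<open>n\<close> arbitrarily large.
\<close>

section \<open>Cubes, visiting times and elementary facts\<close>

text \<open>Half-open in every coordinate, so that the translates by multiples of \<open>1/M\<close>
  tile the unit cube exactly; the tiling count relies on this.\<close>

definition half_open_cube :: "real ^ 'd \<Rightarrow> real \<Rightarrow> (real ^ 'd) set" where
  "half_open_cube a s = {x. \<forall>i. a $ i \<le> x $ i \<and> x $ i < a $ i + s}"

text \<open>Times \<open>n\<close> are collected, not points: a time counts once however many
  \<open>m\<close> bring it into \<open>A\<close>, so cardinalities can be compared through maps on
  times.\<close>

definition visits :: "real ^ 'd \<Rightarrow> nat \<Rightarrow> (real ^ 'd) set \<Rightarrow> nat set" where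
  "visits \<alpha> N A = {n \<in> {1..N}. \<exists>m. real n *\<^sub>R \<alpha> - real_vec m \<in> A}"

lemma real_vec_diff: "real_vec (m - n) = real_vec m - real_vec n"
  by (simp add: real_vec_def vec_eq_iff)

lemma real_vec_nth [simp]: "real_vec m $ i = of_int (m $ i)"
  by (simp add: real_vec_def)

lemma finite_visits [simp]: "finite (visits \<alpha> N A)"
  by (simp add: visits_def)

lemma finite_bounded_functions: "finite {y :: 'd::finite \<Rightarrow> nat. \<forall>i. y i < L}"
  and card_bounded_functions: "card {y :: 'd \<Rightarrow> nat. \<forall>i. y i < L} = L ^ CARD('d)"
proof -
  have *: "{y :: 'd \<Rightarrow> nat. \<forall>i. y i < L} = PiE UNIV (\<lambda>_. {..<L})"
    by (auto simp: PiE_UNIV_domain)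
  show "finite {y :: 'd::finite \<Rightarrow> nat. \<forall>i. y i < L}"
    unfolding * by (intro finite_PiE) auto
  show "card {y :: 'd \<Rightarrow> nat. \<forall>i. y i < L} = L ^ CARD('d)"
    unfolding * by (simp add: card_PiE)
qed

lemma infnorm_less_iff:
  fixes x :: "real ^ 'd"
  shows "infnorm x < r \<longleftrightarrow> (\<forall>i. \<bar>x $ i\<bar> < r)"
  unfolding infnorm_Max by (subst Max_less_iff) (auto simp: Basis_vec_def inner_axis inner_axis')

lemma torus_norm_le: "torus_norm x \<le> infnorm (x - real_vec k)"
  using torus_norm_attained[of x] by auto

subsection \<open>Visits to cubes under irrational rotation\<close>

lemma rat_independent_int:
  fixes \<alpha> :: "real ^ 'd"
  assumes "rat_independent_with_one \<alpha>"
    and "of_int c0 + (\<Sum>i\<in>UNIV. of_int (c i) * \<alpha> $ i) = 0"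
  shows "c0 = 0 \<and> (\<forall>i. c i = 0)"
  using assms(1)[unfolded rat_independent_with_one_def, rule_format, of "of_int c0" "\<lambda>i. of_int (c i)"]
    assms(2) by simp

text \<open>Kronecker's simultaneous approximation theorem, carried over from families indexed by an
  initial segment of the naturals to the coordinates of a vector.\<close>

lemma kronecker_vec:
  fixes \<alpha> x :: "real ^ 'd"
  assumes ind: "rat_independent_with_one \<alpha>" and "\<eta> > 0"
  shows "\<exists>k m. \<forall>i. \<bar>of_int k * \<alpha> $ i - of_int (m $ i) - x $ i\<bar> < \<eta>"
proof -
  \<comment> \<open>The reals as a module over the integers; \<open>independent\<close> below refers
    to this structure.\<close>
  interpret Modules.module "(\<lambda>r x. real_of_int r * x)"
    by (simp add: Modules.module.intro distrib_left mult.commute)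
  let ?d = "CARD('d)"
  obtain h :: "nat \<Rightarrow> 'd" where h: "bij_betw h {..<?d} UNIV"
    using ex_bij_betw_nat_finite[of "UNIV :: 'd set"] by (auto simp: atLeast0LessThan)
  \<comment> \<open>The coordinates come first and the entry 1 is put last, at index
    \<open>?d\<close>, as the library theorem requires.\<close>
  define \<theta> where "\<theta> = (\<lambda>i. if i < ?d then \<alpha> $ h i else 1)"
  \<comment> \<open>\<open>independent\<close> speaks of the image set, which would hide
    repetitions. A repeated value is itself a nontrivial relation:
    \<open>\<alpha> $ h i - \<alpha> $ h j = 0\<close>, or \<open>\<alpha> $ h i - 1 = 0\<close>
    when the later index is \<open>?d\<close>.\<close>
  have inj: "inj_on \<theta> {..?d}"
  proof (rule inj_onI)
    have delta: "(\<Sum>l\<in>UNIV. of_int (of_bool (l = j)) * \<alpha> $ l) = \<alpha> $ j" for j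
      by (subst sum.cong[OF refl, of UNIV _ "\<lambda>l. if l = j then \<alpha> $ l else 0"]) auto
    have ne: "\<theta> i \<noteq> \<theta> j" if ij: "i < j" "j \<le> ?d" for i j
    proof
      assume eq: "\<theta> i = \<theta> j"
      show False
      proof (cases "j < ?d")
        case True
        then have hij: "h i \<noteq> h j"
          using h ij by (metis bij_betw_imp_inj_on inj_onD lessThan_iff less_trans nat_neq_iff)
        have "(\<Sum>l\<in>UNIV. of_int (of_bool (l = h i) - of_bool (l = h j)) * \<alpha> $ l) = \<alpha> $ h i - \<alpha> $ h j"
          by (simp add: left_diff_distrib sum_subtractf delta)
        then show False
          using rat_independent_int[OF ind, of 0 "\<lambda>l. of_bool (l = h i) - of_bool (l = h j)"]
            eq ij True hij by (auto simp: \<theta>_def of_bool_def split: if_splits)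
      next
        case False
        have "(\<Sum>l\<in>UNIV. of_int (of_bool (l = h i)) * \<alpha> $ l) = \<alpha> $ h i"
          by (rule delta)
        then show False
          using rat_independent_int[OF ind, of "-1" "\<lambda>l. of_bool (l = h i)"] eq ij False
          by (auto simp: \<theta>_def split: if_splits)
      qed
    qed
    fix i j assume "i \<in> {..?d}" "j \<in> {..?d}" "\<theta> i = \<theta> j"
    then show "i = j" using ne[of i j] ne[of j i] by (metis atMost_iff nat_neq_iff)
  qed
  have "independent (\<theta> ` {..?d})"
    unfolding dependent_finite[OF finite_imageI[OF finite_atMost]]
  proof (clarify)
    fix u i
    assume sum0: "(\<Sum>v\<in>\<theta> ` {..?d}. real_of_int (u v) * v) = 0" and i: "i \<le> ?d" and un: "u (\<theta> i) \<noteq> 0"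
    have "(\<Sum>j\<le>?d. real_of_int (u (\<theta> j)) * \<theta> j) = 0"
      using sum0 inj by (subst (asm) sum.reindex) auto
    then have "real_of_int (u 1) + (\<Sum>j<?d. real_of_int (u (\<alpha> $ h j)) * \<alpha> $ h j) = 0"
      unfolding lessThan_Suc_atMost[symmetric] by (simp add: \<theta>_def add.commute)
    also have "(\<Sum>j<?d. real_of_int (u (\<alpha> $ h j)) * \<alpha> $ h j) = (\<Sum>l\<in>UNIV. real_of_int (u (\<alpha> $ l)) * \<alpha> $ l)"
      by (rule sum.reindex_bij_betw[OF h])
    finally have "u 1 = 0 \<and> (\<forall>l. u (\<alpha> $ l) = 0)"
      by (rule rat_independent_int[OF ind])
    then show False using un by (auto simp: \<theta>_def split: if_splits)
  qed
  moreover have "\<theta> ?d = 1" by (simp add: \<theta>_def)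
  ultimately obtain k m where km: "\<And>i. i < ?d \<Longrightarrow> \<bar>of_int k * \<theta> i - of_int (m i) - x $ h i\<bar> < \<eta>"
    using Kronecker_thm_2[OF _ inj _ \<open>\<eta> > 0\<close>, of "\<lambda>i. x $ h i"] by blast
  have "\<bar>of_int k * \<alpha> $ i - of_int ((\<chi> i. m (inv_into {..<?d} h i)) $ i) - x $ i\<bar> < \<eta>" for i
  proof -
    have "inv_into {..<?d} h i < ?d" "h (inv_into {..<?d} h i) = i"
      using h by (metis UNIV_I bij_betw_imp_surj_on inv_into_into lessThan_iff,
          metis UNIV_I bij_betw_imp_surj_on f_inv_into_f)
    then show ?thesis using km[of "inv_into {..<?d} h i"] by (simp add: \<theta>_def)
  qed
  then show ?thesis by blast
qed

text \<open>Modulo the lattice it suffices to approximate the finitely many points of a grid of mesh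
  \<open>1/L\<close>; a common bound for the shifts used there serves every \<open>x\<close>. This
  uniformity is what keeps later errors bounded.\<close>

lemma kronecker_uniform:
  fixes \<alpha> :: "real ^ 'd"
  assumes ind: "rat_independent_with_one \<alpha>" and "\<eta> > 0"
  shows "\<exists>J. \<forall>x. \<exists>k m. \<bar>k\<bar> \<le> int J \<and> of_int k *\<^sub>R \<alpha> - real_vec m \<in> half_open_cube x \<eta>"
proof -
  obtain L :: nat where L: "L > 0" "1 / real L < \<eta> / 4"
    using \<open>\<eta> > 0\<close> by (metis divide_pos_pos nat_approx_posE zero_less_Suc zero_less_numeral)
  let ?Y = "{y :: 'd \<Rightarrow> nat. \<forall>i. y i < L}"
  have "\<exists>km. \<forall>i. \<bar>of_int (fst km) * \<alpha> $ i - of_int (snd km $ i) - real (y i) / real L\<bar> < \<eta> / 4"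
    for y :: "'d \<Rightarrow> nat"
    using kronecker_vec[OF ind, of "\<eta> / 4" "\<chi> i. real (y i) / real L"] \<open>\<eta> > 0\<close>
    by (simp only: vec_lambda_beta) auto
  then have "\<exists>km. \<forall>y :: 'd \<Rightarrow> nat. \<forall>i. \<bar>of_int (fst (km y)) * \<alpha> $ i - of_int (snd (km y) $ i) - real (y i) / real L\<bar> < \<eta> / 4"
    by (intro choice) blast
  then obtain km where km: "\<And>(y :: 'd \<Rightarrow> nat) i. \<bar>of_int (fst (km y)) * \<alpha> $ i - of_int (snd (km y) $ i) - real (y i) / real L\<bar> < \<eta> / 4"
    by blast
  define k where "k y = fst (km y)" for y
  define m where "m y = snd (km y)" for y
  note km = km[folded k_def m_def]
  \<comment> \<open>A sum in place of a maximum: any common bound of the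
    \<open>\<bar>k y\<bar>\<close> will do.\<close>
  define J where "J = (\<Sum>y\<in>?Y. nat \<bar>k y\<bar>)"
  have J: "\<bar>k y\<bar> \<le> int J" if "y \<in> ?Y" for y
  proof -
    have "nat \<bar>k y\<bar> \<le> J" unfolding J_def
      by (rule member_le_sum) (use that finite_bounded_functions in auto)
    then show ?thesis by linarith
  qed
  have "\<exists>k m. \<bar>k\<bar> \<le> int J \<and> of_int k *\<^sub>R \<alpha> - real_vec m \<in> half_open_cube x \<eta>" for x
  proof -
    \<comment> \<open>\<open>t\<close> is the centre of the cube, \<open>y\<close> indexes the grid
      point below its fractional part, and \<open>m'\<close> absorbs its integer part. Grid error
      and Kronecker error are each below \<open>\<eta> / 4\<close>, so their sum stays below the
      half side \<open>\<eta> / 2\<close>.\<close>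
    define t where "t = (\<lambda>i. x $ i + \<eta> / 2)"
    define y where "y = (\<lambda>i. nat \<lfloor>real L * frac (t i)\<rfloor>)"
    define m' where "m' = m y - (\<chi> i. \<lfloor>t i\<rfloor>)"
    have fl: "\<lfloor>real L * frac (t i)\<rfloor> \<ge> 0" for i by (simp add: frac_ge_0)
    have yr: "real (y i) = of_int \<lfloor>real L * frac (t i)\<rfloor>" for i
      using fl[of i] by (simp add: y_def)
    have "y i < L" for i
    proof -
      have "real L * frac (t i) < real L" using L frac_lt_1 by simp
      then have "real (y i) < real L" unfolding yr by linarith
      then show ?thesis by simp
    qed
    then have "y \<in> ?Y" by blast
    moreover have "of_int (k y) *\<^sub>R \<alpha> - real_vec m' \<in> half_open_cube x \<eta>"
      unfolding half_open_cube_def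
    proof (intro CollectI allI)
      fix i
      have "\<bar>real (y i) - real L * frac (t i)\<bar> \<le> 1" unfolding yr by linarith
      then have "\<bar>(real (y i) - real L * frac (t i)) / real L\<bar> \<le> 1 / real L"
        using L by (simp add: abs_divide divide_right_mono)
      moreover have "(real (y i) - real L * frac (t i)) / real L = real (y i) / real L - frac (t i)"
        using L by (simp add: field_simps)
      ultimately have "\<bar>real (y i) / real L - frac (t i)\<bar> < \<eta> / 4" using L by linarith
      then have "real (y i) / real L < frac (t i) + \<eta> / 4" "frac (t i) - \<eta> / 4 < real (y i) / real L"
        unfolding abs_less_iff by linarith+
      moreover have "of_int (k y) * \<alpha> $ i - of_int (m y $ i) < real (y i) / real L + \<eta> / 4"
        "real (y i) / real L - \<eta> / 4 < of_int (k y) * \<alpha> $ i - of_int (m y $ i)"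
        using km[of y i] unfolding abs_less_iff by linarith+
      moreover have "of_int (m' $ i) = of_int (m y $ i) - (x $ i + \<eta> / 2 - frac (t i))"
        by (simp add: m'_def frac_def t_def)
      ultimately have "x $ i \<le> of_int (k y) * \<alpha> $ i - of_int (m' $ i)"
        "of_int (k y) * \<alpha> $ i - of_int (m' $ i) < x $ i + \<eta>"
        by linarith+
      then show "x $ i \<le> (of_int (k y) *\<^sub>R \<alpha> - real_vec m') $ i \<and> (of_int (k y) *\<^sub>R \<alpha> - real_vec m') $ i < x $ i + \<eta>"
        by simp
    qed
    ultimately show ?thesis using J by blast
  qed
  then show ?thesis by blast
qed

section \<open>Equidistribution of the visits\<close>

text \<open>Take \<open>k\<close> such that \<open>k \<alpha>\<close> lies, modulo the lattice, in
  the cube at \<open>b - a\<close> of side \<open>\<eta>\<close>. Sending \<open>n\<close> to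
  \<open>n + k\<close> turns visits to the first cube into visits to the second, and only the times
  pushed out of \<open>1..N\<close> are lost.\<close>

lemma card_visits_translate:
  fixes \<alpha> :: "real ^ 'd"
  assumes ind: "rat_independent_with_one \<alpha>" and "\<eta> > 0"
  shows "\<exists>J. \<forall>a b N s. card (visits \<alpha> N (half_open_cube a s))
                     \<le> card (visits \<alpha> N (half_open_cube b (s + \<eta>))) + J"
proof -
  obtain J where J: "\<And>x. \<exists>k m. \<bar>k\<bar> \<le> int J \<and> of_int k *\<^sub>R \<alpha> - real_vec m \<in> half_open_cube x \<eta>"
    using kronecker_uniform[OF assms] by blast
  have "card (visits \<alpha> N (half_open_cube a s)) \<le> card (visits \<alpha> N (half_open_cube b (s + \<eta>))) + J"
    for a b N s
  proof -
    obtain k m where k: "\<bar>k\<bar> \<le> int J" and km: "of_int k *\<^sub>R \<alpha> - real_vec m \<in> half_open_cube (b - a) \<eta>"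
      using J by blast
    let ?A = "visits \<alpha> N (half_open_cube a s)" and ?B = "visits \<alpha> N (half_open_cube b (s + \<eta>))"
    let ?I = "{n \<in> ?A. 1 \<le> int n + k \<and> int n + k \<le> int N}"
    have "card ?I \<le> card ?B"
    proof (rule card_inj_on_le[where f = "\<lambda>n. nat (int n + k)"])
      show "inj_on (\<lambda>n. nat (int n + k)) ?I" by (rule inj_onI) (simp, linarith)
      show "(\<lambda>n. nat (int n + k)) ` ?I \<subseteq> ?B"
      proof (rule image_subsetI)
        fix n assume n: "n \<in> ?I"
        then obtain m' where m': "real n *\<^sub>R \<alpha> - real_vec m' \<in> half_open_cube a s"
          by (auto simp: visits_def)
        have r: "real (nat (int n + k)) = real n + of_int k" using n by simp
        have "real (nat (int n + k)) *\<^sub>R \<alpha> - real_vec (m' + m) \<in> half_open_cube b (s + \<eta>)"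
          unfolding half_open_cube_def
        proof (intro CollectI allI)
          fix i
          have 1: "a $ i \<le> real n * \<alpha> $ i - m' $ i" "real n * \<alpha> $ i - m' $ i < a $ i + s"
            using m' by (auto simp: half_open_cube_def)
          have 2: "b $ i - a $ i \<le> of_int k * \<alpha> $ i - m $ i" "of_int k * \<alpha> $ i - m $ i < b $ i - a $ i + \<eta>"
            using km by (auto simp: half_open_cube_def)
          show "b $ i \<le> (real (nat (int n + k)) *\<^sub>R \<alpha> - real_vec (m' + m)) $ i \<and>
            (real (nat (int n + k)) *\<^sub>R \<alpha> - real_vec (m' + m)) $ i < b $ i + (s + \<eta>)"
            unfolding r using 1 2 by (simp add: algebra_simps)
        qed
        then show "nat (int n + k) \<in> ?B" using n unfolding visits_def by auto
      qed
    qed simp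
    moreover have "card (?A - ?I) \<le> J"
    proof -
      \<comment> \<open>A forward shift loses only the last \<open>k\<close> times, a backward shift
        only the first \<open>- k\<close>.\<close>
      have "?A - ?I \<subseteq> (if k \<ge> 0 then {N - nat k<..N} else {1..nat (- k)})"
        by (auto simp: visits_def split: if_splits)
      then have "card (?A - ?I) \<le> card (if k \<ge> 0 then {N - nat k<..N} else {1..nat (- k)})"
        by (intro card_mono) auto
      also have "\<dots> \<le> nat \<bar>k\<bar>" by auto
      finally have "card (?A - ?I) \<le> nat \<bar>k\<bar>" .
      then show ?thesis using k by linarith
    qed
    moreover have "card ?A \<le> card ?I + card (?A - ?I)"
      using card_Un_le[of ?I "?A - ?I"] by (simp add: Un_absorb1)
    ultimately show ?thesis by linarith
  qed
  then show ?thesis by blast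
qed

text \<open>The cubes tile the unit cube at \<open>b\<close>, a fundamental domain of the lattice,
  so each time visits exactly one of them.\<close>

lemma sum_card_visits_tiling:
  fixes \<alpha> b :: "real ^ 'd"
  assumes "M > 0"
  shows "(\<Sum>v | \<forall>i. v i < M. card (visits \<alpha> N (half_open_cube (b + (\<chi> i. real (v i) / real M)) (1 / real M)))) = N"
proof -
  let ?V = "{v :: 'd \<Rightarrow> nat. \<forall>i. v i < M}"
  let ?Q = "\<lambda>v. half_open_cube (b + (\<chi> i. real (v i) / real M)) (1 / real M)"
  \<comment> \<open>Index of the tile that contains \<open>n \<alpha>\<close>: fractional parts
    relative to the corner \<open>b\<close>, scaled by \<open>M\<close> and rounded down.\<close>
  define w where "w = (\<lambda>n i. nat \<lfloor>real M * frac (real n * \<alpha> $ i - b $ i)\<rfloor>)"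
  have w0: "\<lfloor>real M * frac z\<rfloor> \<ge> 0" for z by (simp add: frac_ge_0)
  have wr: "real (w n i) = of_int \<lfloor>real M * frac (real n * \<alpha> $ i - b $ i)\<rfloor>" for n i
    by (simp add: w_def w0)
  have w_lt: "w n i < M" for n i
  proof -
    have "real M * frac (real n * \<alpha> $ i - b $ i) < real M" using assms frac_lt_1 by simp
    then have "real (w n i) < real M" unfolding wr by linarith
    then show ?thesis by simp
  qed
  have mem: "real n *\<^sub>R \<alpha> - real_vec (\<chi> i. \<lfloor>real n * \<alpha> $ i - b $ i\<rfloor>) \<in> ?Q (w n)" for n
    unfolding half_open_cube_def
  proof (intro CollectI allI)
    fix i
    let ?z = "frac (real n * \<alpha> $ i - b $ i)"
    have "real (w n i) \<le> real M * ?z" "real M * ?z < real (w n i) + 1" unfolding wr by linarith+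
    then have "real (w n i) / real M \<le> ?z" "?z < real (w n i) / real M + 1 / real M"
      using assms by (simp_all add: field_simps)
    then show "(b + (\<chi> i. real (w n i) / real M)) $ i \<le> (real n *\<^sub>R \<alpha> - real_vec (\<chi> i. \<lfloor>real n * \<alpha> $ i - b $ i\<rfloor>)) $ i \<and>
      (real n *\<^sub>R \<alpha> - real_vec (\<chi> i. \<lfloor>real n * \<alpha> $ i - b $ i\<rfloor>)) $ i < (b + (\<chi> i. real (w n i) / real M)) $ i + 1 / real M"
      by (simp add: frac_def)
  qed
  \<comment> \<open>The tile lies in the unit cube at \<open>b\<close>, which forces
    \<open>m\<close> to be the floor and then \<open>v\<close> to be \<open>w n\<close>.\<close>
  have uniq: "v = w n" if v: "v \<in> ?V" and m: "real n *\<^sub>R \<alpha> - real_vec m \<in> ?Q v" for v n m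
  proof
    fix i
    let ?z = "real n * \<alpha> $ i - b $ i"
    have 1: "real (v i) / real M \<le> ?z - of_int (m $ i)" "?z - of_int (m $ i) < real (v i) / real M + 1 / real M"
      using m[unfolded half_open_cube_def, simplified, rule_format, of i] by (simp_all add: algebra_simps)
    have "real (v i) + 1 \<le> real M" using v[unfolded mem_Collect_eq, rule_format, of i] by linarith
    then have 2: "real (v i) / real M + 1 / real M \<le> 1" using assms by (simp add: field_simps)
    have 3: "real (v i) / real M \<ge> 0" by simp
    have "\<lfloor>?z\<rfloor> = m $ i" using 1 2 3 by linarith
    then have fr: "frac ?z = ?z - of_int (m $ i)" by (simp add: frac_def)
    have "real (v i) \<le> real M * frac ?z" "real M * frac ?z < real (v i) + 1"
      using 1 assms unfolding fr by (simp_all add: field_simps)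
    then have "\<lfloor>real M * frac ?z\<rfloor> = int (v i)" by linarith
    then show "v i = w n i" by (simp add: w_def)
  qed
  have "N = card (\<Union>v\<in>?V. visits \<alpha> N (?Q v))"
  proof -
    have "(\<Union>v\<in>?V. visits \<alpha> N (?Q v)) = {1..N}"
    proof (intro equalityI subsetI)
      fix n assume "n \<in> {1..N}"
      then have "n \<in> visits \<alpha> N (?Q (w n))" using mem[of n] unfolding visits_def by blast
      then show "n \<in> (\<Union>v\<in>?V. visits \<alpha> N (?Q v))" using w_lt by blast
    qed (auto simp: visits_def)
    then show ?thesis by (simp only: card_atLeastAtMost)
  qed
  also have "\<dots> = (\<Sum>v\<in>?V. card (visits \<alpha> N (?Q v)))"
  proof (rule card_UN_disjoint)
    show "\<forall>v\<in>?V. \<forall>v'\<in>?V. v \<noteq> v' \<longrightarrow> visits \<alpha> N (?Q v) \<inter> visits \<alpha> N (?Q v') = {}"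
    proof (intro ballI impI equals0I)
      fix v v' n assume v: "v \<in> ?V" "v' \<in> ?V" "v \<noteq> v'"
        and "n \<in> visits \<alpha> N (?Q v) \<inter> visits \<alpha> N (?Q v')"
      then obtain m m' where "real n *\<^sub>R \<alpha> - real_vec m \<in> ?Q v" "real n *\<^sub>R \<alpha> - real_vec m' \<in> ?Q v'"
        unfolding visits_def by blast
      then show False using uniq[OF v(1)] uniq[OF v(2)] v(3) by metis
    qed
  qed (use finite_bounded_functions in auto)
  finally show ?thesis ..
qed

text \<open>Averaging: up to \<open>J\<close> the count is at most that of each tile of side
  \<open>1/M\<close>, and the \<open>M^d\<close> tiles share \<open>N\<close> visits. The strict
  inequality leaves room for the enlargement \<open>1 / M - s\<close>.\<close>

lemma card_visits_upper:
  fixes \<alpha> :: "real ^ 'd"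
  assumes ind: "rat_independent_with_one \<alpha>" and M: "M > 0" "s < 1 / real M"
  shows "\<exists>J. \<forall>a N. real (card (visits \<alpha> N (half_open_cube a s))) \<le> real N / real M ^ CARD('d) + real J"
proof -
  obtain J where J: "\<And>a b N. card (visits \<alpha> N (half_open_cube a s)) \<le> card (visits \<alpha> N (half_open_cube b (1 / real M))) + J"
    using card_visits_translate[OF ind, of "1 / real M - s"] M
    by (metis add.commute diff_add_cancel diff_gt_0_iff_gt)
  have "real (card (visits \<alpha> N (half_open_cube a s))) \<le> real N / real M ^ CARD('d) + real J" for a N
  proof -
    let ?V = "{v :: 'd \<Rightarrow> nat. \<forall>i. v i < M}"
    have "(\<Sum>v\<in>?V. card (visits \<alpha> N (half_open_cube a s)))
       \<le> (\<Sum>v\<in>?V. card (visits \<alpha> N (half_open_cube (a + (\<chi> i. real (v i) / real M)) (1 / real M))) + J)"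
      by (intro sum_mono J)
    also have "\<dots> = N + M ^ CARD('d) * J"
      using sum_card_visits_tiling[OF M(1), of \<alpha> N a] by (simp add: sum.distrib card_bounded_functions)
    finally have "M ^ CARD('d) * card (visits \<alpha> N (half_open_cube a s)) \<le> N + M ^ CARD('d) * J"
      by (simp add: card_bounded_functions)
    then have "real (M ^ CARD('d) * card (visits \<alpha> N (half_open_cube a s))) \<le> real (N + M ^ CARD('d) * J)"
      by (simp only: of_nat_le_iff)
    then show ?thesis using M by (simp add: field_simps)
  qed
  then show ?thesis by blast
qed

text \<open>The same averaging with the roles of cube and tile exchanged.\<close>

lemma card_visits_lower:
  fixes \<alpha> :: "real ^ 'd"
  assumes ind: "rat_independent_with_one \<alpha>" and M: "M > 0" "1 / real M < s"
  shows "\<exists>J. \<forall>a N. real N / real M ^ CARD('d) \<le> real (card (visits \<alpha> N (half_open_cube a s))) + real J"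
proof -
  obtain J where J: "\<And>a b N. card (visits \<alpha> N (half_open_cube b (1 / real M))) \<le> card (visits \<alpha> N (half_open_cube a s)) + J"
    using card_visits_translate[OF ind, of "s - 1 / real M"] M
    by (metis add.commute diff_add_cancel diff_gt_0_iff_gt)
  have "real N / real M ^ CARD('d) \<le> real (card (visits \<alpha> N (half_open_cube a s))) + real J" for a N
  proof -
    let ?V = "{v :: 'd \<Rightarrow> nat. \<forall>i. v i < M}"
    have "N = (\<Sum>v\<in>?V. card (visits \<alpha> N (half_open_cube (a + (\<chi> i. real (v i) / real M)) (1 / real M))))"
      by (rule sum_card_visits_tiling[OF M(1), symmetric])
    also have "\<dots> \<le> (\<Sum>v\<in>?V. card (visits \<alpha> N (half_open_cube a s)) + J)"
      by (intro sum_mono J)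
    finally have "N \<le> M ^ CARD('d) * (card (visits \<alpha> N (half_open_cube a s)) + J)"
      by (simp add: card_bounded_functions)
    then have "real N \<le> real (M ^ CARD('d) * (card (visits \<alpha> N (half_open_cube a s)) + J))"
      by (simp only: of_nat_le_iff)
    then show ?thesis using M by (simp add: field_simps)
  qed
  then show ?thesis by blast
qed

subsection \<open>Coprime visits\<close>

text \<open>Pigeonhole: the cube is covered by \<open>L^d\<close> cells of side
  \<open>\<delta>\<close>, and two times \<open>n < n'\<close> in one cell would give
  \<open>n' - n\<close> a torus norm below \<open>\<delta>\<close>.\<close>

lemma card_visits_separated:
  fixes \<alpha> a :: "real ^ 'd"
  assumes sep: "\<And>n. n \<in> {1..N} \<Longrightarrow> \<delta> \<le> torus_norm (real n *\<^sub>R \<alpha>)"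
    and "\<delta> > 0" and s: "s \<le> real L * \<delta>" and "N' \<le> N"
  shows "card (visits \<alpha> N' (half_open_cube a s)) \<le> L ^ CARD('d)"
proof -
  let ?V = "visits \<alpha> N' (half_open_cube a s)"
  have "\<exists>m. \<forall>n\<in>?V. real n *\<^sub>R \<alpha> - real_vec (m n) \<in> half_open_cube a s"
    by (rule bchoice) (auto simp: visits_def)
  then obtain m where m: "\<And>n. n \<in> ?V \<Longrightarrow> real n *\<^sub>R \<alpha> - real_vec (m n) \<in> half_open_cube a s"
    by blast
  define z where "z n i = (real n * \<alpha> $ i - of_int (m n $ i) - a $ i) / \<delta>" for n i
  have z: "0 \<le> z n i" "z n i < real L" if "n \<in> ?V" for n i
  proof -
    have 1: "a $ i \<le> real n * \<alpha> $ i - of_int (m n $ i)" "real n * \<alpha> $ i - of_int (m n $ i) < a $ i + s"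
      using m[OF that] by (auto simp: half_open_cube_def)
    then show "0 \<le> z n i" using \<open>\<delta> > 0\<close> by (simp add: z_def)
    show "z n i < real L" unfolding z_def pos_divide_less_eq[OF \<open>\<delta> > 0\<close>] using 1 s by linarith
  qed
  have z\<delta>: "z n i * \<delta> = real n * \<alpha> $ i - of_int (m n $ i) - a $ i" for n i
    using \<open>\<delta> > 0\<close> by (simp add: z_def)
  define f where "f n i = nat \<lfloor>z n i\<rfloor>" for n i
  have no: False if n: "n \<in> ?V" "n' \<in> ?V" "n < n'" "f n = f n'" for n n'
  proof -
    have "infnorm (real (n' - n) *\<^sub>R \<alpha> - real_vec (m n' - m n)) < \<delta>"
      unfolding infnorm_less_iff
    proof
      fix i
      have "nat \<lfloor>z n i\<rfloor> = nat \<lfloor>z n' i\<rfloor>" using n(4) by (metis f_def)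
      then have "\<lfloor>z n i\<rfloor> = \<lfloor>z n' i\<rfloor>" using z(1)[OF n(1), of i] z(1)[OF n(2), of i]
        by (metis eq_nat_nat_iff zero_le_floor)
      then have "\<bar>z n' i - z n i\<bar> < 1" by linarith
      then have "\<bar>z n' i - z n i\<bar> * \<delta> < \<delta>" using \<open>\<delta> > 0\<close> by simp
      moreover have "\<bar>z n' i - z n i\<bar> * \<delta> = \<bar>(z n' i - z n i) * \<delta>\<bar>"
        using \<open>\<delta> > 0\<close> by (simp add: abs_mult)
      moreover have "(z n' i - z n i) * \<delta> = (real (n' - n) *\<^sub>R \<alpha> - real_vec (m n' - m n)) $ i"
        using n(3) unfolding left_diff_distrib[of _ _ \<delta>] z\<delta> by (simp add: of_nat_diff algebra_simps)
      ultimately show "\<bar>(real (n' - n) *\<^sub>R \<alpha> - real_vec (m n' - m n)) $ i\<bar> < \<delta>" by simp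
    qed
    moreover have "n' - n \<in> {1..N}" using n \<open>N' \<le> N\<close> by (auto simp: visits_def)
    ultimately show False using sep torus_norm_le by (metis not_le order_trans)
  qed
  have "inj_on f ?V"
  proof (rule inj_onI)
    fix n n' assume "n \<in> ?V" "n' \<in> ?V" "f n = f n'"
    then show "n = n'" using no[of n n'] no[of n' n] by (metis linorder_neqE_nat)
  qed
  moreover have "f ` ?V \<subseteq> {y. \<forall>i. y i < L}"
  proof (intro image_subsetI CollectI allI)
    fix n i assume "n \<in> ?V"
    then have "0 \<le> z n i" "z n i < real L" by (rule z)+
    then show "f n i < L" unfolding f_def by (simp add: nat_less_iff floor_less_iff)
  qed
  ultimately have "card ?V \<le> card {y :: 'd \<Rightarrow> nat. \<forall>i. y i < L}"
    by (rule card_inj_on_le) (rule finite_bounded_functions)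
  then show ?thesis by (simp add: card_bounded_functions)
qed

text \<open>Serves the cubes \<open>Q/k\<close> with \<open>k\<close> large, which shrink to the
  origin: a visit would put some \<open>n \<alpha>\<close> closer than \<open>\<delta>\<close> to
  the lattice.\<close>

lemma visits_near_origin_empty:
  fixes \<alpha> a :: "real ^ 'd"
  assumes sep: "\<And>n. n \<in> {1..N} \<Longrightarrow> \<delta> \<le> torus_norm (real n *\<^sub>R \<alpha>)"
    and "N' \<le> N" and R: "\<And>i. \<bar>a $ i\<bar> + s < \<delta>" and "s \<ge> 0"
  shows "visits \<alpha> N' (half_open_cube a s) = {}"
proof (rule equals0I)
  fix n assume "n \<in> visits \<alpha> N' (half_open_cube a s)"
  then obtain m where m: "real n *\<^sub>R \<alpha> - real_vec m \<in> half_open_cube a s" and n: "n \<in> {1..N}"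
    using \<open>N' \<le> N\<close> by (auto simp: visits_def)
  have "infnorm (real n *\<^sub>R \<alpha> - real_vec m) < \<delta>"
    unfolding infnorm_less_iff
  proof
    fix i
    have "a $ i \<le> (real n *\<^sub>R \<alpha> - real_vec m) $ i" "(real n *\<^sub>R \<alpha> - real_vec m) $ i < a $ i + s"
      using m by (auto simp: half_open_cube_def)
    then show "\<bar>(real n *\<^sub>R \<alpha> - real_vec m) $ i\<bar> < \<delta>" using R[of i] \<open>s \<ge> 0\<close> by linarith
  qed
  then show False using sep[OF n] torus_norm_le[of "real n *\<^sub>R \<alpha>" m] by linarith
qed

section \<open>The sieve by the greatest common divisor\<close>

definition coprime_visits :: "real ^ 'd \<Rightarrow> nat \<Rightarrow> (real ^ 'd) set \<Rightarrow> nat set" where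
  "coprime_visits \<alpha> N A = {n \<in> {1..N}. \<exists>m \<in> coprime_lattice n. real n *\<^sub>R \<alpha> - real_vec m \<in> A}"

text \<open>Let \<open>k\<close> be the gcd of \<open>n\<close> and the coordinates of
  \<open>m\<close>. Unless \<open>k = 1\<close>, the time \<open>n / k\<close> visits the cube
  scaled by \<open>1 / k\<close>, and multiplication by \<open>k\<close> recovers
  \<open>n\<close>.\<close>

lemma card_visits_sieve:
  fixes \<alpha> a :: "real ^ 'd"
  shows "card (visits \<alpha> N (half_open_cube a s))
    \<le> card (coprime_visits \<alpha> N (half_open_cube a s))
      + (\<Sum>k=2..N. card (visits \<alpha> (N div k) (half_open_cube (a /\<^sub>R real k) (s / real k))))"
proof -
  let ?W = "\<lambda>k. visits \<alpha> (N div k) (half_open_cube (a /\<^sub>R real k) (s / real k))"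
  have "visits \<alpha> N (half_open_cube a s)
    \<subseteq> coprime_visits \<alpha> N (half_open_cube a s) \<union> (\<Union>k\<in>{2..N}. (\<lambda>n. k * n) ` ?W k)"
  proof
    fix n assume "n \<in> visits \<alpha> N (half_open_cube a s)"
    then obtain m where n: "1 \<le> n" "n \<le> N" and m: "real n *\<^sub>R \<alpha> - real_vec m \<in> half_open_cube a s"
      by (auto simp: visits_def)
    define g where "g = Gcd (insert (int n) (range (\<lambda>i. m $ i)))"
    show "n \<in> coprime_visits \<alpha> N (half_open_cube a s) \<union> (\<Union>k\<in>{2..N}. (\<lambda>n. k * n) ` ?W k)"
    proof (cases "g = 1")
      case True
      then have "m \<in> coprime_lattice n" by (simp add: coprime_lattice_def g_def)
      then show ?thesis using n m by (auto simp: coprime_visits_def)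
    next
      case False
      define k where "k = nat g"
      have gn: "g dvd int n" and gm: "g dvd m $ i" for i
        unfolding g_def by (rule Gcd_dvd; simp)+
      have "g \<ge> 0" unfolding g_def by (rule Gcd_int_greater_eq_0)
      moreover have "g \<noteq> 0" using gn n by auto
      ultimately have k: "int k = g" "k \<ge> 2" using False by (auto simp: k_def)
      have "k dvd n" using gn unfolding k(1)[symmetric] by simp
      then obtain n' where n': "n = k * n'" ..
      define m' where "m' = (\<chi> i. m $ i div int k)"
      have m': "m $ i = int k * m' $ i" for i
        using gm[of i] unfolding m'_def k(1) by simp
      have "n' \<ge> 1" "n' \<le> N div k"
        using n n' k(2) by (auto simp: less_eq_div_iff_mult_less_eq mult.commute Suc_le_eq)
      moreover have "real n' *\<^sub>R \<alpha> - real_vec m' \<in> half_open_cube (a /\<^sub>R real k) (s / real k)"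
        unfolding half_open_cube_def
      proof (intro CollectI allI)
        fix i
        have "a $ i \<le> real n * \<alpha> $ i - of_int (m $ i)" "real n * \<alpha> $ i - of_int (m $ i) < a $ i + s"
          using m by (auto simp: half_open_cube_def)
        then show "(a /\<^sub>R real k) $ i \<le> (real n' *\<^sub>R \<alpha> - real_vec m') $ i \<and>
          (real n' *\<^sub>R \<alpha> - real_vec m') $ i < (a /\<^sub>R real k) $ i + s / real k"
          using k(2) unfolding n' m' by (simp add: field_simps)
      qed
      ultimately have "n' \<in> ?W k" by (auto simp: visits_def)
      moreover have "k \<le> N" using \<open>k dvd n\<close> n by (metis dvd_imp_le le_trans less_le_trans zero_less_one)
      ultimately show ?thesis using n' k(2) by auto
    qed
  qed
  then have "card (visits \<alpha> N (half_open_cube a s))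
    \<le> card (coprime_visits \<alpha> N (half_open_cube a s) \<union> (\<Union>k\<in>{2..N}. (\<lambda>n. k * n) ` ?W k))"
    by (rule card_mono[rotated]) (auto simp: coprime_visits_def)
  also have "\<dots> \<le> card (coprime_visits \<alpha> N (half_open_cube a s)) + card (\<Union>k\<in>{2..N}. (\<lambda>n. k * n) ` ?W k)"
    by (rule card_Un_le)
  also have "card (\<Union>k\<in>{2..N}. (\<lambda>n. k * n) ` ?W k) \<le> (\<Sum>k=2..N. card ((\<lambda>n. k * n) ` ?W k))"
    by (rule card_UN_le) simp
  also have "\<dots> \<le> (\<Sum>k=2..N. card (?W k))"
    by (intro sum_mono card_image_le) simp
  finally show ?thesis by simp
qed

text \<open>Telescoping. With large \<open>K\<close> it makes the tail of the sieve small; with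
  \<open>K = 1\<close> it bounds the head.\<close>

lemma sum_inverse_squares_le:
  assumes "K > 0"
  shows "(\<Sum>k=Suc K..N. 1 / real k ^ 2) \<le> 1 / real K"
proof (cases "K \<le> N")
  case True
  then have "(\<Sum>k=Suc K..N. 1 / real k ^ 2) \<le> 1 / real K - 1 / real N"
  proof (induction N rule: dec_induct)
    case (step n)
    have n: "real n > 0" using assms step by simp
    have "1 / real (Suc n) ^ 2 \<le> 1 / (real n * real (Suc n))"
      by (rule divide_left_mono) (use n in \<open>auto simp: power2_eq_square\<close>)
    also have "\<dots> = 1 / real n - 1 / real (Suc n)" using n by (simp add: field_simps)
    finally show ?case using step by (simp add: sum.cl_ivl_Suc)
  qed simp
  also have "\<dots> \<le> 1 / real K" by simp
  finally show ?thesis .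
qed simp

lemma one_plus_power_le:
  fixes y :: real
  assumes "y \<ge> 0"
  shows "(1 + y) ^ d \<le> 2 ^ d + 2 ^ d * y ^ d"
proof -
  have "(1 + y) ^ d \<le> (2 * max 1 y) ^ d" by (rule power_mono) (use assms in auto)
  also have "\<dots> = 2 ^ d * max 1 y ^ d" by (simp add: power_mult_distrib)
  also have "\<dots> \<le> 2 ^ d * (1 + y ^ d)"
    by (rule mult_left_mono) (use assms in \<open>auto simp: max_def\<close>)
  finally show ?thesis by (simp add: algebra_simps)
qed

text \<open>Splits the pigeonhole bound into a constant and a volume term; only the latter decreases
  when the cube is scaled by \<open>1 / k\<close>.\<close>

lemma real_card_visits_separated:
  fixes \<alpha> a :: "real ^ 'd"
  assumes sep: "\<And>n. n \<in> {1..N} \<Longrightarrow> \<delta> \<le> torus_norm (real n *\<^sub>R \<alpha>)"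
    and "\<delta> > 0" and "s \<ge> 0" and "N' \<le> N"
  shows "real (card (visits \<alpha> N' (half_open_cube a s))) \<le> 2 ^ CARD('d) + 2 ^ CARD('d) * (s / \<delta>) ^ CARD('d)"
proof -
  define L where "L = nat \<lceil>s / \<delta>\<rceil>"
  have L: "s / \<delta> \<le> real L" unfolding L_def by (rule real_nat_ceiling_ge)
  then have "s \<le> real L * \<delta>" using \<open>\<delta> > 0\<close> by (simp add: field_simps)
  from card_visits_separated[OF sep \<open>\<delta> > 0\<close> this \<open>N' \<le> N\<close>]
  have "real (card (visits \<alpha> N' (half_open_cube a s))) \<le> real L ^ CARD('d)"
    by (metis of_nat_le_iff of_nat_power)
  also have "\<dots> \<le> (1 + s / \<delta>) ^ CARD('d)"
  proof (rule power_mono)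
    have "s / \<delta> \<ge> 0" using assms by simp
    then show "real L \<le> 1 + s / \<delta>" unfolding L_def by linarith
  qed simp
  also have "\<dots> \<le> 2 ^ CARD('d) + 2 ^ CARD('d) * (s / \<delta>) ^ CARD('d)"
    using assms by (intro one_plus_power_le) simp
  finally show ?thesis .
qed

text \<open>This is where \<open>d \<ge> 2\<close> enters: it makes \<open>k\<^sup>-\<^sup>d\<close> summable and \<open>1/\<delta> = O(N\<^sup>1\<^sup>/\<^sup>d)\<close> negligible against \<open>N\<close>.\<close>

lemma sum_card_visits_tail:
  fixes \<alpha> a :: "real ^ 'd"
  assumes sep: "\<And>n. n \<in> {1..N} \<Longrightarrow> \<delta> \<le> torus_norm (real n *\<^sub>R \<alpha>)"
    and "\<delta> > 0" and "s \<ge> 0" and "K > 0" and d: "CARD('d) \<ge> 2"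
    and R: "\<And>i. \<bar>a $ i\<bar> + s \<le> R"
  shows "(\<Sum>k=Suc K..N. real (card (visits \<alpha> (N div k) (half_open_cube (a /\<^sub>R real k) (s / real k)))))
    \<le> 2 ^ CARD('d) * (R / \<delta>) + 2 ^ CARD('d) * (s / \<delta>) ^ CARD('d) / real K"
proof -
  let ?d = "CARD('d)"
  let ?c = "\<lambda>k. real (card (visits \<alpha> (N div k) (half_open_cube (a /\<^sub>R real k) (s / real k))))"
  have "R \<ge> 0" using R[of undefined] \<open>s \<ge> 0\<close> by linarith
  \<comment> \<open>For \<open>k \<le> R / \<delta>\<close> the separation bound applies, and its
    constant is paid at most \<open>R / \<delta>\<close> times. For larger \<open>k\<close> the
    scaled cube lies closer than \<open>\<delta>\<close> to the origin and has no visits.\<close>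
  have le: "?c k \<le> 2 ^ ?d * of_bool (real k \<le> R / \<delta>) + 2 ^ ?d * (s / \<delta>) ^ ?d * (1 / real k ^ 2)"
    if k: "k \<in> {Suc K..N}" for k
  proof (cases "real k \<le> R / \<delta>")
    case True
    have k1: "real k \<ge> 1" using k by simp
    have "?c k \<le> 2 ^ ?d + 2 ^ ?d * ((s / real k) / \<delta>) ^ ?d"
      using \<open>\<delta> > 0\<close> \<open>s \<ge> 0\<close> by (intro real_card_visits_separated[OF sep]) auto
    also have "((s / real k) / \<delta>) ^ ?d = (s / \<delta>) ^ ?d * (1 / real k ^ ?d)"
      by (simp add: power_divide power_mult_distrib)
    also have "\<dots> \<le> (s / \<delta>) ^ ?d * (1 / real k ^ 2)"
      using k1 d \<open>\<delta> > 0\<close> \<open>s \<ge> 0\<close> by (intro mult_left_mono divide_left_mono power_increasing) auto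
    finally show ?thesis using True by simp
  next
    case False
    then have "R / real k < \<delta>" using k \<open>\<delta> > 0\<close> by (simp add: field_simps)
    moreover have "\<bar>(a /\<^sub>R real k) $ i\<bar> + s / real k \<le> R / real k" for i
    proof -
      have "\<bar>(a /\<^sub>R real k) $ i\<bar> + s / real k = (\<bar>a $ i\<bar> + s) / real k"
        by (simp add: abs_mult divide_inverse algebra_simps)
      then show ?thesis using R[of i] by (simp add: divide_right_mono)
    qed
    ultimately have "visits \<alpha> (N div k) (half_open_cube (a /\<^sub>R real k) (s / real k)) = {}"
      using \<open>s \<ge> 0\<close> by (intro visits_near_origin_empty[OF sep]) (auto intro: le_less_trans)
    then show ?thesis using \<open>s \<ge> 0\<close> \<open>\<delta> > 0\<close> by simp
  qed
  have "(\<Sum>k=Suc K..N. ?c k)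
     \<le> (\<Sum>k=Suc K..N. 2 ^ ?d * of_bool (real k \<le> R / \<delta>) + 2 ^ ?d * (s / \<delta>) ^ ?d * (1 / real k ^ 2))"
    by (rule sum_mono) (rule le)
  also have "\<dots> = 2 ^ ?d * (\<Sum>k=Suc K..N. of_bool (real k \<le> R / \<delta>))
      + 2 ^ ?d * (s / \<delta>) ^ ?d * (\<Sum>k=Suc K..N. 1 / real k ^ 2)"
    by (simp only: sum.distrib sum_distrib_left)
  also have "(\<Sum>k=Suc K..N. of_bool (real k \<le> R / \<delta>) :: real) = real (card {k \<in> {Suc K..N}. real k \<le> R / \<delta>})"
    by (simp add: Int_def conj_commute)
  also have "\<dots> \<le> real (card {1..nat \<lfloor>R / \<delta>\<rfloor>})"
  proof -
    have "{k \<in> {Suc K..N}. real k \<le> R / \<delta>} \<subseteq> {1..nat \<lfloor>R / \<delta>\<rfloor>}"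
      by (auto simp: le_nat_floor)
    then show ?thesis by (simp only: of_nat_le_iff) (rule card_mono, auto)
  qed
  also have "\<dots> \<le> R / \<delta>" using \<open>R \<ge> 0\<close> \<open>\<delta> > 0\<close> by simp
  also have "(\<Sum>k=Suc K..N. 1 / real k ^ 2) \<le> 1 / real K"
    by (rule sum_inverse_squares_le[OF \<open>K > 0\<close>])
  finally show ?thesis using \<open>s \<ge> 0\<close> \<open>\<delta> > 0\<close>
    by (simp add: mult_left_mono)
qed

text \<open>\<open>Q/k\<close> has side \<open>1 / (M k) < 1 / (M k - 1)\<close>, so
  equidistribution applies to it; as only finitely many \<open>k\<close> occur, the errors add up to
  a constant. The factor 2 in the denominator is what leaves coprime visits a positive
  share.\<close>

lemma sum_card_visits_head:
  fixes \<alpha> :: "real ^ 'd"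
  assumes ind: "rat_independent_with_one \<alpha>" and d: "CARD('d) \<ge> 2" and M: "M \<ge> 2"
  shows "\<exists>J. \<forall>a N. (\<Sum>k=2..K. real (card (visits \<alpha> (N div k) (half_open_cube (a /\<^sub>R real k) (1 / real M / real k)))))
    \<le> real N / (2 * (real M - 1) ^ CARD('d)) + real J"
proof -
  let ?d = "CARD('d)"
  have "\<exists>J. \<forall>a N. k \<ge> 2 \<longrightarrow> real (card (visits \<alpha> N (half_open_cube a (1 / real M / real k))))
     \<le> real N / real (M * k - 1) ^ ?d + real J" for k
  proof (cases "k \<ge> 2")
    case True
    have Mk: "M * k \<ge> 2 * 2" by (rule mult_le_mono[OF M True])
    have "1 / real P < 1 / real (P - 1)" if "P \<ge> 4" for P
      using that by (simp add: field_simps of_nat_diff)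
    from this[of "M * k"] Mk have "1 / real (M * k) < 1 / real (M * k - 1)" by linarith
    then have "1 / real M / real k < 1 / real (M * k - 1)" by simp
    then show ?thesis using card_visits_upper[OF ind, of "M * k - 1"] Mk by auto
  qed simp
  then obtain J where J: "\<And>k a N. k \<ge> 2 \<Longrightarrow>
     real (card (visits \<alpha> N (half_open_cube a (1 / real M / real k)))) \<le> real N / real (M * k - 1) ^ ?d + real (J k)"
    by metis
  have "(\<Sum>k=2..K. real (card (visits \<alpha> (N div k) (half_open_cube (a /\<^sub>R real k) (1 / real M / real k)))))
    \<le> real N / (2 * (real M - 1) ^ ?d) + real (\<Sum>k=2..K. J k)" for a N
  proof -
    have le: "real (card (visits \<alpha> (N div k) (half_open_cube (a /\<^sub>R real k) (1 / real M / real k))))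
      \<le> real N / (2 * (real M - 1) ^ ?d) * (1 / real k ^ 2) + real (J k)" if k: "k \<ge> 2" for k
    proof -
      have Mk: "real (M * k - 1) \<ge> real k * (real M - 1)" "real M - 1 > 0"
        using k M mult_le_mono[OF M k] by (auto simp: of_nat_diff algebra_simps)
      have Mkd: "real (M * k - 1) ^ ?d \<ge> real k ^ ?d * (real M - 1) ^ ?d"
        using Mk power_mono[OF Mk(1), of ?d] by (simp add: power_mult_distrib)
      have kd: "real k ^ 2 \<le> real k ^ ?d" using k d by (intro power_increasing) auto
      have "real (N div k) \<le> real N / real k" by (rule of_nat_div_le_of_nat)
      \<comment> \<open>One factor \<open>1 / k\<close> is estimated by \<open>1/2\<close>, the
        remaining \<open>1 / k^d\<close> by \<open>1 / k^2\<close>, whose sum from 2 on is at most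
        1.\<close>
      also have "\<dots> \<le> real N / 2" using k by (intro divide_left_mono) auto
      finally have "real (N div k) / real (M * k - 1) ^ ?d \<le> (real N / 2) / (real k ^ 2 * (real M - 1) ^ ?d)"
      proof (rule frac_le[rotated])
        show "real k ^ 2 * (real M - 1) ^ ?d \<le> real (M * k - 1) ^ ?d"
          by (rule order_trans[OF mult_right_mono[OF kd] Mkd]) (use Mk(2) in simp)
      qed (use k Mk(2) in auto)
      then show ?thesis using J[OF k, of "N div k" "a /\<^sub>R real k"] by (simp add: mult.commute mult.left_commute)
    qed
    have "(\<Sum>k=2..K. real (card (visits \<alpha> (N div k) (half_open_cube (a /\<^sub>R real k) (1 / real M / real k)))))
      \<le> (\<Sum>k=2..K. real N / (2 * (real M - 1) ^ ?d) * (1 / real k ^ 2) + real (J k))"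
      by (intro sum_mono le) auto
    also have "\<dots> = real N / (2 * (real M - 1) ^ ?d) * (\<Sum>k=Suc 1..K. 1 / real k ^ 2) + real (\<Sum>k=2..K. J k)"
      by (simp add: sum.distrib sum_distrib_left numeral_2_eq_2)
    also have "\<dots> \<le> real N / (2 * (real M - 1) ^ ?d) * 1 + real (\<Sum>k=2..K. J k)"
      using sum_inverse_squares_le[of 1 K] M by (intro add_right_mono mult_left_mono) auto
    finally show ?thesis by simp
  qed
  then show ?thesis by blast
qed

text \<open>Balance in units of \<open>N / (M + 1)^d\<close>: all visits amount to 1, the head of
  the sieve removes at most \<open>3/4\<close> by \<open>M3\<close>, the tail at most
  \<open>1/8\<close>, and \<open>1/8\<close> remains. The other errors are at most of order
  \<open>sqrt N\<close>. \<open>C\<close> may depend on \<open>a\<close> and \<open>M\<close>, not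
  on \<open>N\<close>.\<close>

lemma card_coprime_visits_ge:
  fixes \<alpha> a :: "real ^ 'd"
  assumes ind: "rat_independent_with_one \<alpha>" and d: "CARD('d) \<ge> 2" and M: "M \<ge> 2"
    and M3: "2 * (real M + 1) ^ CARD('d) \<le> 3 * (real M - 1) ^ CARD('d)" and "c > 0"
  shows "\<exists>C. \<forall>N \<delta>. N > 0 \<and> \<delta> = c * real N powr (- 1 / real CARD('d))
           \<and> (\<forall>n\<in>{1..N}. \<delta> \<le> torus_norm (real n *\<^sub>R \<alpha>)) \<longrightarrow>
         real N / (8 * (real M + 1) ^ CARD('d)) - C * sqrt (real N)
           \<le> real (card (coprime_visits \<alpha> N (half_open_cube a (1 / real M))))"
proof -
  let ?d = "CARD('d)"
  define s where "s = 1 / real M"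
  define X where "X = (real M + 1) ^ ?d"
  define R where "R = infnorm a + s"
  have s0: "s > 0" using M by (simp add: s_def)
  have X0: "X > 0" by (simp add: X_def)
  have R: "\<bar>a $ i\<bar> + s \<le> R" for i
    using component_le_infnorm_cart[of a i] by (simp add: R_def)
  have "R \<ge> 0" using s0 infnorm_pos_le[of a] by (simp add: R_def)
  \<comment> \<open>Since \<open>(s / \<delta>)^d = N / (c M)^d\<close>, this size of
    \<open>K\<close> makes the volume term of the tail at most \<open>1/16\<close> of
    \<open>N / M^d\<close>.\<close>
  obtain K0 :: nat where "16 * 2 ^ ?d / c ^ ?d \<le> real K0" using real_arch_simple by blast
  then obtain K :: nat where K: "K > 0" "16 * 2 ^ ?d / c ^ ?d \<le> real K"
    by (intro that[of "Suc K0"]) auto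
  \<comment> \<open>The lower count needs tiles strictly smaller than the cube, hence
    \<open>M + 1\<close>.\<close>
  obtain J1 where J1: "\<And>N. real N / real (M + 1) ^ ?d \<le> real (card (visits \<alpha> N (half_open_cube a s))) + real J1"
    using card_visits_lower[OF ind, of "M + 1" s] M by (auto simp: s_def frac_less2)
  obtain J2 where J2: "\<And>N. (\<Sum>k=2..K. real (card (visits \<alpha> (N div k) (half_open_cube (a /\<^sub>R real k) (s / real k)))))
    \<le> real N / (2 * (real M - 1) ^ CARD('d)) + real J2"
    using sum_card_visits_head[OF ind d M, of K] unfolding s_def by blast
  have "real N / (8 * X) - (real J1 + real J2 + 2 ^ ?d * (R / c)) * sqrt (real N)
      \<le> real (card (coprime_visits \<alpha> N (half_open_cube a s)))"
    if N: "N > 0" and \<delta>: "\<delta> = c * real N powr (- 1 / real ?d)"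
      and sep: "\<forall>n\<in>{1..N}. \<delta> \<le> torus_norm (real n *\<^sub>R \<alpha>)" for N \<delta>
  proof -
    let ?c = "\<lambda>k. real (card (visits \<alpha> (N div k) (half_open_cube (a /\<^sub>R real k) (s / real k))))"
    have \<delta>0: "\<delta> > 0" using \<open>c > 0\<close> N by (simp add: \<delta>)
    have Nd: "\<delta> ^ ?d = c ^ ?d / real N"
    proof -
      have "(real N powr (- 1 / real ?d)) ^ ?d = real N powr (- 1)"
        using N by (simp add: powr_realpow[symmetric] powr_powr)
      then show ?thesis unfolding \<delta> power_mult_distrib by (simp add: powr_minus_divide)
    qed
    \<comment> \<open>\<open>d \<ge> 2\<close> bounds \<open>N^(1/d)\<close> by
      \<open>sqrt N\<close>.\<close>
    have "1 / \<delta> = (1 / c) * real N powr (1 / real ?d)"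
      using N by (simp add: \<delta> powr_minus_divide)
    also have "\<dots> \<le> (1 / c) * sqrt (real N)"
      unfolding powr_half_sqrt[symmetric, OF of_nat_0_le_iff]
      using N d \<open>c > 0\<close> by (intro mult_left_mono powr_mono) auto
    finally have "2 ^ ?d * R * (1 / \<delta>) \<le> 2 ^ ?d * R * ((1 / c) * sqrt (real N))"
      by (rule mult_left_mono) (use \<open>R \<ge> 0\<close> in simp)
    then have R\<delta>: "2 ^ ?d * (R / \<delta>) \<le> 2 ^ ?d * (R / c) * sqrt (real N)" by simp
    have tail: "(\<Sum>k=Suc K..N. ?c k) \<le> 2 ^ ?d * (R / \<delta>) + 2 ^ ?d * (s / \<delta>) ^ ?d / real K"
      using sep s0 R by (intro sum_card_visits_tail \<delta>0 K d) auto
    have "2 ^ ?d * (s / \<delta>) ^ ?d / real K \<le> real N / (8 * X)"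
    proof -
      have Mc: "2 ^ ?d * (s / \<delta>) ^ ?d / real K = (2 ^ ?d / c ^ ?d / real K) * (real N / real M ^ ?d)"
        using M \<open>c > 0\<close> N unfolding power_divide Nd s_def by simp
      have "2 ^ ?d / c ^ ?d / real K \<le> 1 / 16"
        using K unfolding pos_divide_le_eq[OF of_nat_0_less_iff[THEN iffD2, OF K(1)]] by (simp add: mult.commute)
      then have 1: "(2 ^ ?d / c ^ ?d / real K) * (real N / real M ^ ?d) \<le> 1 / 16 * (real N / real M ^ ?d)"
        by (rule mult_right_mono) simp
      have "(real M - 1) ^ ?d \<le> real M ^ ?d" using M by (intro power_mono) auto
      \<comment> \<open>With this, \<open>1/16\<close> of \<open>N / M^d\<close> is at most
        \<open>1/8\<close> of \<open>N / X\<close>.\<close>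
      then have "X \<le> 2 * real M ^ ?d" using M3 zero_le_power[of "real M" ?d] unfolding X_def by linarith
      then have "real N / (2 * real M ^ ?d) \<le> real N / X"
        using X0 M by (intro divide_left_mono) auto
      then show ?thesis using 1 unfolding Mc by simp
    qed
    with tail R\<delta> have tail: "(\<Sum>k=Suc K..N. ?c k) \<le> 2 ^ ?d * (R / c) * sqrt (real N) + real N / (8 * X)"
      by linarith
    have "real N / (2 * (real M - 1) ^ ?d) \<le> 3 / 4 * (real N / X)"
    proof -
      have Y: "(real M - 1) ^ ?d > 0" using M by simp
      have "2 * X \<le> 3 * (real M - 1) ^ ?d" using M3 by (simp add: X_def)
      then have "real N * (2 * X) \<le> real N * (3 * (real M - 1) ^ ?d)" by (rule mult_left_mono) simp
      then show ?thesis using X0 Y by (simp add: field_simps)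
    qed
    with J2[of N] have head: "(\<Sum>k=2..K. ?c k) \<le> 3 / 4 * (real N / X) + real J2" by linarith
    \<comment> \<open>Only an inequality, because \<open>K\<close> may exceed
      \<open>N\<close>.\<close>
    have "(\<Sum>k=2..N. ?c k) \<le> (\<Sum>k=2..K. ?c k) + (\<Sum>k=Suc K..N. ?c k)"
    proof -
      have "(\<Sum>k=2..N. ?c k) \<le> (\<Sum>k\<in>{2..K} \<union> {Suc K..N}. ?c k)"
        by (rule sum_mono2) auto
      also have "\<dots> = (\<Sum>k=2..K. ?c k) + (\<Sum>k=Suc K..N. ?c k)"
        by (rule sum.union_disjoint) auto
      finally show ?thesis .
    qed
    moreover have "real (card (visits \<alpha> N (half_open_cube a s)))
       \<le> real (card (coprime_visits \<alpha> N (half_open_cube a s))) + (\<Sum>k=2..N. ?c k)"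
      using card_visits_sieve[of \<alpha> N a s] by (simp only: of_nat_le_iff[symmetric, where 'a=real] of_nat_add of_nat_sum)
    moreover have "real N / X \<le> real (card (visits \<alpha> N (half_open_cube a s))) + real J1"
      using J1[of N] by (simp add: X_def add.commute)
    ultimately have *: "real (card (coprime_visits \<alpha> N (half_open_cube a s)))
        \<ge> real N / X - real J1 - 3 / 4 * (real N / X) - real J2 - 2 ^ ?d * (R / c) * sqrt (real N) - real N / (8 * X)"
      using head tail by linarith
    \<comment> \<open>\<open>sqrt N \<ge> 1\<close> lets the bounded errors be absorbed into the
      \<open>sqrt N\<close> term.\<close>
    have "real J1 + real J2 \<le> (real J1 + real J2) * sqrt (real N)"
      using mult_left_mono[of 1 "sqrt (real N)" "real J1 + real J2"] N by simp
    moreover have "real N / (8 * X) = real N / X / 8" by simp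
    ultimately show ?thesis using * by (simp add: distrib_right)
  qed
  then show ?thesis unfolding s_def X_def by blast
qed

subsection \<open>Measure of the approximable points\<close>

text \<open>Vitali balls covering a bounded part of \<open>S\<close> inside an open \<open>T\<close> with \<open>T - S\<close> small: at least
  the fraction \<open>\<delta>\<close> of their total measure lies in \<open>T - S\<close>.\<close>

lemma negligible_if_complement_density_ge:
  fixes S :: "('a :: euclidean_space) set"
  assumes S: "S \<in> sets lebesgue" and "\<delta> > 0"
    and dens: "\<And>x r. x \<in> S \<Longrightarrow> r > 0 \<Longrightarrow>
      \<exists>d. 0 < d \<and> d < r \<and> \<delta> * measure lebesgue (ball x d) \<le> measure lebesgue (ball x d - S)"
  shows "negligible S"
proof -
  have "negligible (S \<inter> ball 0 (real n))" for n
  proof -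
    let ?S = "S \<inter> ball 0 (real n)"
    have S': "?S \<in> lmeasurable" 
      using fmeasurable_Int_fmeasurable[OF lmeasurable_ball S] by (simp add: Int_commute)
    have le: "\<delta> * measure lebesgue ?S \<le> e" if "e > 0" for e
    proof -
      obtain T where T: "open T" "?S \<subseteq> T" "T - ?S \<in> lmeasurable" "emeasure lebesgue (T - ?S) < ennreal e"
        using sets_lebesgue_outer_open[of ?S e] S' \<open>e > 0\<close> by (auto simp: fmeasurableD)
      let ?K = "{(x, d). x \<in> ?S \<and> 0 < d \<and> ball x d \<subseteq> T \<inter> ball 0 (real n)
                 \<and> \<delta> * measure lebesgue (ball x d) \<le> measure lebesgue (ball x d - S)}"
      obtain C where C: "countable C" "C \<subseteq> ?K"
        and pw: "pairwise (\<lambda>i j. disjnt (ball (fst i) (snd i)) (ball (fst j) (snd j))) C"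
        and neg: "negligible (?S - (\<Union>i\<in>C. ball (fst i) (snd i)))"
      proof (rule Vitali_covering_theorem_balls[of ?S ?K fst snd])
        fix x and r :: real assume x: "x \<in> ?S" and "r > 0"
        have "open (T \<inter> ball 0 (real n))" using T by auto
        then obtain t where t: "t > 0" "ball x t \<subseteq> T \<inter> ball 0 (real n)"
          using x T by (meson IntI Int_iff open_contains_ball subsetD)
        \<comment> \<open>\<open>min r t\<close> serves both the fineness that Vitali's theorem asks
          for and the containment in \<open>T\<close>.\<close>
        obtain d where d: "0 < d" "d < min r t" "\<delta> * measure lebesgue (ball x d) \<le> measure lebesgue (ball x d - S)"
          using dens[of x "min r t"] x \<open>r > 0\<close> t by auto
        have "ball x d \<subseteq> ball x t" using d by (simp add: subset_ball)
        then show "\<exists>i. i \<in> ?K \<and> x \<in> ball (fst i) (snd i) \<and> snd i < r"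
          using d t x by (intro exI[of _ "(x, d)"]) auto
      qed
      let ?B = "\<lambda>i. ball (fst i :: 'a) (snd i)"
      have pos: "emeasure lebesgue (?B i - ?S) \<ge> ennreal \<delta> * emeasure lebesgue (?B i)" if "i \<in> C" for i
      proof -
        have i: "?B i \<subseteq> ball 0 (real n)" "\<delta> * measure lebesgue (?B i) \<le> measure lebesgue (?B i - S)"
          using that C by (auto simp: case_prod_unfold)
        \<comment> \<open>Inside the ball of radius \<open>n\<close> it makes no difference whether
          \<open>S\<close> or \<open>?S\<close> is removed, so the density hypothesis
          transfers.\<close>
        have "?B i - ?S = ?B i - S" using i(1) by blast
        moreover have "?B i - S \<in> lmeasurable" using S by (intro fmeasurable.Diff fmeasurable_Diff) auto
        ultimately show ?thesis
          using i(2) \<open>\<delta> > 0\<close> by (simp add: emeasure_eq_measure2 ennreal_mult[symmetric] ennreal_leI)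
      qed
      have "disjoint_family_on ?B C"
        using pw by (auto simp: disjoint_family_on_def pairwise_def disjnt_def)
      then have un: "emeasure lebesgue (\<Union>i\<in>C. ?B i) = (\<integral>\<^sup>+i. emeasure lebesgue (?B i) \<partial>count_space C)"
        by (intro emeasure_UN_countable) (use C in auto)
      have "disjoint_family_on (\<lambda>i. ?B i - ?S) C"
        using pw by (fastforce simp: disjoint_family_on_def pairwise_def disjnt_def)
      then have un': "emeasure lebesgue (\<Union>i\<in>C. ?B i - ?S) = (\<integral>\<^sup>+i. emeasure lebesgue (?B i - ?S) \<partial>count_space C)"
        using S' by (intro emeasure_UN_countable) (use C in auto)
      have Bm: "(\<Union>i\<in>C. ?B i) \<in> sets lebesgue" using C(1) by (intro sets.countable_UN'') auto
      have "emeasure lebesgue ?S \<le> emeasure lebesgue ((\<Union>i\<in>C. ?B i) \<union> (?S - (\<Union>i\<in>C. ?B i)))"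
        using Bm neg S' by (intro emeasure_mono) (auto intro!: sets.Un sets.Diff simp: fmeasurableD)
      also have "\<dots> = emeasure lebesgue (\<Union>i\<in>C. ?B i)"
        by (rule emeasure_Un_null_set[OF Bm]) (use neg in \<open>simp add: negligible_iff_null_sets\<close>)
      finally have "ennreal \<delta> * emeasure lebesgue ?S \<le> ennreal \<delta> * emeasure lebesgue (\<Union>i\<in>C. ?B i)"
        by (rule mult_left_mono) simp
      also have "\<dots> = (\<integral>\<^sup>+i. ennreal \<delta> * emeasure lebesgue (?B i) \<partial>count_space C)"
        unfolding un by (simp add: nn_integral_cmult)
      also have "\<dots> \<le> (\<integral>\<^sup>+i. emeasure lebesgue (?B i - ?S) \<partial>count_space C)"
        using pos by (intro nn_integral_mono) auto
      also have "\<dots> = emeasure lebesgue (\<Union>i\<in>C. ?B i - ?S)" by (rule un'[symmetric])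
      also have "\<dots> \<le> emeasure lebesgue (T - ?S)"
      proof (rule emeasure_mono)
        have "?B i \<subseteq> T" if "i \<in> C" for i using that C by (auto simp: case_prod_unfold)
        then show "(\<Union>i\<in>C. ?B i - ?S) \<subseteq> T - ?S" by blast
      qed (use T in \<open>simp add: fmeasurableD\<close>)
      also have "\<dots> \<le> ennreal e" using T by simp
      finally have "ennreal (\<delta> * measure lebesgue ?S) \<le> ennreal e"
        using \<open>\<delta> > 0\<close> S' by (simp add: emeasure_eq_measure2 ennreal_mult)
      then show ?thesis using \<open>e > 0\<close> by (simp add: ennreal_le_iff)
    qed
    have "\<delta> * measure lebesgue ?S \<le> 0"
      by (rule field_le_epsilon) (use le in simp)
    then have "measure lebesgue ?S = 0" using \<open>\<delta> > 0\<close>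
      by (simp add: mult_le_0_iff order_antisym)
    then show ?thesis using S' by (simp add: negligible_iff_measure)
  qed
  then have "negligible (\<Union>n. S \<inter> ball 0 (real n))" by (rule negligible_Union_nat)
  also have "(\<Union>n. S \<inter> ball 0 (real n)) = S"
    by (auto simp: reals_Archimedean2)
  finally show ?thesis .
qed

section \<open>Balls around coprime visits and their density\<close>

text \<open>Euclidean balls are used because they lie inside the sup-norm balls of equal radius. A
  point lying in these sets for all \<open>n0\<close> and arbitrarily small
  \<open>\<epsilon>\<close> has lower limit 0.\<close>

definition coprime_approximable :: "real ^ 'd \<Rightarrow> real \<Rightarrow> nat \<Rightarrow> (real ^ 'd) set" where
  "coprime_approximable \<alpha> \<epsilon> n0 = (\<Union>n\<in>{n0..}. \<Union>m\<in>coprime_lattice n.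
     ball (real n *\<^sub>R \<alpha> - real_vec m) (\<epsilon> * real n powr (- 1 / real CARD('d))))"

lemma open_coprime_approximable: "open (coprime_approximable \<alpha> \<epsilon> n0)"
  unfolding coprime_approximable_def by auto

text \<open>The quantifier order is the point: \<open>\<delta>\<close> precedes \<open>M\<close>,
  \<open>a\<close> and \<open>n0\<close>. This is possible because the disjoint small balls and the
  ball \<open>B\<close> both have volume of order \<open>M^(-d)\<close>.\<close>

lemma measure_coprime_approximable_ge:
  fixes \<alpha> a :: "real ^ 'd"
  assumes \<alpha>: "\<alpha> \<in> nonsingular_frequencies" and d: "CARD('d) \<ge> 2" and \<epsilon>: "0 < \<epsilon>" "\<epsilon> \<le> 1"
  shows "\<exists>\<delta>>0. \<exists>M0. \<forall>M\<ge>M0. \<forall>a n0. let B = ball a ((real CARD('d) + 1) / real M) in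
    \<delta> * measure lebesgue B \<le> measure lebesgue (B \<inter> coprime_approximable \<alpha> \<epsilon> n0)"
proof -
  let ?d = "CARD('d)"
  let ?\<mu> = "measure lebesgue"
  have ind: "rat_independent_with_one \<alpha>" using \<alpha> by (simp add: nonsingular_frequencies_def)
  obtain c Nj where c: "c > 0" and Nj: "\<And>j. Nj j > 0" "filterlim Nj at_top sequentially"
    and "\<And>j. Min ((\<lambda>n. torus_norm (real n *\<^sub>R \<alpha>)) ` {1..Nj j}) \<ge> c * real (Nj j) powr (- 1 / real ?d)"
    using \<alpha> unfolding nonsingular_frequencies_def by blast
  then have sep: "\<forall>n\<in>{1..Nj j}. c * real (Nj j) powr (- 1 / real ?d) \<le> torus_norm (real n *\<^sub>R \<alpha>)" for j
    by (subst (asm) Min_ge_iff) (auto simp: Suc_le_eq)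
  \<comment> \<open>\<open>e \<le> c / 2\<close> makes the small balls disjoint,
    \<open>e \<le> \<epsilon>\<close> keeps them in the approximable set, and
    \<open>e \<le> 1\<close> keeps their radius at most \<open>1/M\<close>.\<close>
  define e where "e = min \<epsilon> (c / 2)"
  have e: "0 < e" "e \<le> \<epsilon>" "e \<le> 1" "2 * e \<le> c" using c \<epsilon> by (auto simp: e_def)
  define V where "V = ?\<mu> (ball (0 :: real ^ 'd) 1)"
  \<comment> \<open>Quotient of the lower bound \<open>e^d / (16 (2 M)^d)\<close> for the small
    balls by the volume \<open>((d + 1) / M)^d\<close> of \<open>B\<close>, both in units of
    \<open>V\<close>; \<open>M\<close> cancels.\<close>
  define \<delta> where "\<delta> = e ^ ?d / (16 * (2 * (real ?d + 1)) ^ ?d)"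
  have "\<delta> > 0" using e by (simp add: \<delta>_def)
  \<comment> \<open>\<open>(M + 1) / (M - 1) = 1 + 2 / (M - 1)\<close> tends to 1, so the condition
    on \<open>M\<close> in the count of coprime visits holds for all large \<open>M\<close>.\<close>
  have "((\<lambda>M. (1 + 2 * inverse (real M - 1)) ^ ?d) \<longlongrightarrow> (1 + 2 * 0) ^ ?d) sequentially"
  proof (intro tendsto_intros)
    have "filterlim (\<lambda>M. - 1 + real M) at_top sequentially"
      by (rule filterlim_tendsto_add_at_top[OF tendsto_const filterlim_real_sequentially])
    then show "((\<lambda>M. inverse (real M - 1)) \<longlongrightarrow> 0) sequentially"
      by (intro tendsto_inverse_0_at_top) simp
  qed
  then have "\<forall>\<^sub>F M in sequentially. (1 + 2 * inverse (real M - 1)) ^ ?d < 3 / 2"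
    by (rule order_tendstoD) simp
  then obtain M1 where M1: "\<And>M. M \<ge> M1 \<Longrightarrow> (1 + 2 * inverse (real M - 1)) ^ ?d < 3 / 2"
    by (auto simp: eventually_sequentially)
  have main: "\<delta> * ?\<mu> (ball a ((real ?d + 1) / real M))
      \<le> ?\<mu> (ball a ((real ?d + 1) / real M) \<inter> coprime_approximable \<alpha> \<epsilon> n0)"
    if M: "M \<ge> max M1 2" for M a n0
  proof -
    define X where "X = (real M + 1) ^ ?d"
    have X0: "X > 0" by (simp add: X_def)
    have M2: "M \<ge> 2" using M by simp
    have "real M + 1 = (1 + 2 * inverse (real M - 1)) * (real M - 1)"
      using M2 by (simp add: field_simps)
    then have "X = (1 + 2 * inverse (real M - 1)) ^ ?d * (real M - 1) ^ ?d"
      by (simp only: X_def power_mult_distrib)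
    also have "\<dots> \<le> 3 / 2 * (real M - 1) ^ ?d"
      using M1[of M] M by (intro mult_right_mono) auto
    finally have M3: "2 * (real M + 1) ^ ?d \<le> 3 * (real M - 1) ^ ?d" by (simp add: X_def)
    obtain C where C: "\<And>N \<delta>. N > 0 \<and> \<delta> = c * real N powr (- 1 / real ?d)
           \<and> (\<forall>n\<in>{1..N}. \<delta> \<le> torus_norm (real n *\<^sub>R \<alpha>)) \<Longrightarrow>
         real N / (8 * X) - C * sqrt (real N)
           \<le> real (card (coprime_visits \<alpha> N (half_open_cube a (1 / real M))))"
      using card_coprime_visits_ge[OF ind d M2 M3 c, of a] unfolding X_def by blast
    have sq: "filterlim (\<lambda>N. sqrt (real N)) at_top sequentially"
      by (rule filterlim_compose[OF sqrt_at_top filterlim_real_sequentially])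
    \<comment> \<open>This gives \<open>C sqrt N + n0 \<le> N / (16 X)\<close>, half of the main
      term \<open>N / (8 X)\<close>. The further demand \<open>N \<ge> M^d\<close> bounds the radius
      \<open>\<rho>\<close> by \<open>1/M\<close>.\<close>
    have "\<forall>\<^sub>F N in sequentially. sqrt (real N) \<ge> 16 * X * (\<bar>C\<bar> + real n0)" 
      using sq by (simp add: filterlim_at_top)
    then have "\<forall>\<^sub>F N in sequentially. sqrt (real N) \<ge> 16 * X * (\<bar>C\<bar> + real n0) \<and> N \<ge> M ^ ?d"
      by (intro eventually_conj eventually_ge_at_top)
    then obtain j where j: "sqrt (real (Nj j)) \<ge> 16 * X * (\<bar>C\<bar> + real n0)" "Nj j \<ge> M ^ ?d"
      using eventually_happens'[OF _ eventually_compose_filterlim[OF _ Nj(2)]] by fastforce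
    define N where "N = Nj j"
    have N: "N > 0" "sqrt (real N) \<ge> 16 * X * (\<bar>C\<bar> + real n0)" "N \<ge> M ^ ?d"
      using Nj(1) j by (auto simp: N_def)
    define \<rho> where "\<rho> = e * real N powr (- 1 / real ?d)"
    have \<rho>0: "\<rho> > 0" using e N by (simp add: \<rho>_def)
    define Q where "Q = half_open_cube a (1 / real M)"
    define S where "S = {n \<in> coprime_visits \<alpha> N Q. n \<ge> n0}"
    have finS: "finite S" by (simp add: S_def coprime_visits_def)
    have cardS: "real (card S) \<ge> real N / (16 * X)"
    proof -
      have "coprime_visits \<alpha> N Q \<subseteq> S \<union> {..<n0}" by (auto simp: S_def)
      from card_mono[OF _ this] finS have "card (coprime_visits \<alpha> N Q) \<le> card (S \<union> {..<n0})" by simp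
      also have "\<dots> \<le> card S + n0" using card_Un_le[of S "{..<n0}"] by simp
      finally have "real (card (coprime_visits \<alpha> N Q)) \<le> real (card S) + real n0" by linarith
      moreover have "real N / (8 * X) - C * sqrt (real N) \<le> real (card (coprime_visits \<alpha> N Q))"
        using N sep[of j] unfolding Q_def N_def by (intro C) auto
      moreover have "C * sqrt (real N) + real n0 \<le> real N / (16 * X)"
      proof -
        have "C * sqrt (real N) + real n0 \<le> \<bar>C\<bar> * sqrt (real N) + real n0 * sqrt (real N)"
          using N(1) mult_left_mono[of 1 "sqrt (real N)" "real n0"]
          by (intro add_mono mult_right_mono) auto
        also have "\<dots> = (16 * X * (\<bar>C\<bar> + real n0)) * sqrt (real N) / (16 * X)"
          using X0 by (simp add: field_simps)
        also have "\<dots> \<le> sqrt (real N) * sqrt (real N) / (16 * X)"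
          using N X0 by (intro divide_right_mono mult_right_mono) auto
        finally show ?thesis by simp
      qed
      moreover have "real N / (8 * X) = 2 * (real N / (16 * X))" by simp
      ultimately show ?thesis by linarith
    qed
    have "\<exists>m. \<forall>n\<in>S. m n \<in> coprime_lattice n \<and> real n *\<^sub>R \<alpha> - real_vec (m n) \<in> Q"
      by (rule bchoice) (auto simp: S_def coprime_visits_def)
    then obtain m where m: "\<And>n. n \<in> S \<Longrightarrow> m n \<in> coprime_lattice n"
        "\<And>n. n \<in> S \<Longrightarrow> real n *\<^sub>R \<alpha> - real_vec (m n) \<in> Q" by blast
    define p where "p n = real n *\<^sub>R \<alpha> - real_vec (m n)" for n
    let ?U = "\<Union>n\<in>S. ball (p n) \<rho>"
    \<comment> \<open>Separation at time \<open>n' - n\<close> puts the centres at least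
      \<open>c N^(-1/d) \<ge> 2 \<rho>\<close> apart in the sup norm, hence in the Euclidean
      norm.\<close>
    have disj: "disjnt (ball (p n) \<rho>) (ball (p n') \<rho>)" if n: "n \<in> S" "n' \<in> S" "n < n'" for n n'
    proof -
      have "n' - n \<in> {1..N}" using n by (auto simp: S_def coprime_visits_def)
      then have "c * real N powr (- 1 / real ?d) \<le> torus_norm (real (n' - n) *\<^sub>R \<alpha>)"
        using sep[of j] unfolding N_def by blast
      also have "\<dots> \<le> infnorm (real (n' - n) *\<^sub>R \<alpha> - real_vec (m n' - m n))" by (rule torus_norm_le)
      also have "real (n' - n) *\<^sub>R \<alpha> - real_vec (m n' - m n) = p n' - p n"
        using n(3) by (simp add: p_def of_nat_diff real_vec_diff algebra_simps)
      also have "infnorm (p n' - p n) \<le> norm (p n' - p n)" by (rule infnorm_le_norm)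
      also have "\<dots> = dist (p n) (p n')" by (simp add: dist_norm norm_minus_commute)
      finally have "c * real N powr (- 1 / real ?d) \<le> dist (p n) (p n')" .
      moreover have "\<rho> + \<rho> \<le> c * real N powr (- 1 / real ?d)"
        using mult_right_mono[OF e(4), of "real N powr (- 1 / real ?d)"] by (simp add: \<rho>_def)
      ultimately show ?thesis unfolding disjnt_def by (intro disjoint_ballI) linarith
    qed
    have "?\<mu> ?U = (\<Sum>n\<in>S. ?\<mu> (ball (p n) \<rho>))"
    proof (rule measure_UNION'[OF finS])
      show "pairwise (\<lambda>n n'. disjnt (ball (p n) \<rho>) (ball (p n') \<rho>)) S"
      proof (rule pairwiseI)
        fix n n' assume "n \<in> S" "n' \<in> S" "n \<noteq> n'"
        then show "disjnt (ball (p n) \<rho>) (ball (p n') \<rho>)"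
          using disj[of n n'] disjnt_sym[OF disj[of n' n]] by (meson linorder_neqE_nat)
      qed
    qed (rule lmeasurable_ball)
    moreover have "?\<mu> (ball (p n) \<rho>) = \<rho> ^ ?d * V" for n
      using \<rho>0 content_ball_conv_unit_ball[of \<rho> "p n"] by (simp add: V_def)
    ultimately have \<mu>U: "?\<mu> ?U = real (card S) * (\<rho> ^ ?d * V)" by simp
    have "?\<mu> ?U \<ge> e ^ ?d / (16 * X) * V"
    proof -
      have "(real N powr (- 1 / real ?d)) ^ ?d = real N powr (- 1)"
        using N by (simp add: powr_realpow[symmetric] powr_powr)
      then have "\<rho> ^ ?d = e ^ ?d / real N"
        unfolding \<rho>_def power_mult_distrib by (simp add: powr_minus_divide)
      moreover have "real N / (16 * X) * (e ^ ?d / real N * V) \<le> real (card S) * (e ^ ?d / real N * V)"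
        using cardS e by (intro mult_right_mono) (auto simp: V_def)
      ultimately show ?thesis using \<mu>U N(1) by simp
    qed
    moreover have "\<delta> * ?\<mu> (ball a ((real ?d + 1) / real M)) \<le> e ^ ?d / (16 * X) * V"
    proof -
      have scale: "e ^ k / (16 * (2 * D) ^ k) * ((D / real M) ^ k * V) = e ^ k / (16 * (2 * real M) ^ k) * V"
        if "D > 0" for D :: real and k
        using that by (simp add: power_divide power_mult_distrib)
      have "?\<mu> (ball a ((real ?d + 1) / real M)) = ((real ?d + 1) / real M) ^ ?d * V"
        using content_ball_conv_unit_ball[of "(real ?d + 1) / real M" a] by (simp add: V_def)
      then have \<mu>: "\<delta> * ?\<mu> (ball a ((real ?d + 1) / real M)) = e ^ ?d / (16 * (2 * real M) ^ ?d) * V"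
        using scale[of "real ?d + 1" ?d] by (simp only: \<delta>_def)
      have "X \<le> (2 * real M) ^ ?d" unfolding X_def using M2 by (intro power_mono) auto
      then have "e ^ ?d / (16 * (2 * real M) ^ ?d) \<le> e ^ ?d / (16 * X)"
        using X0 e M2 by (intro divide_left_mono) auto
      then show ?thesis unfolding \<mu> by (rule mult_right_mono) (simp add: V_def)
    qed
    moreover have "?\<mu> ?U \<le> ?\<mu> (ball a ((real ?d + 1) / real M) \<inter> coprime_approximable \<alpha> \<epsilon> n0)"
    proof (rule measure_mono_fmeasurable)
      show "ball a ((real ?d + 1) / real M) \<inter> coprime_approximable \<alpha> \<epsilon> n0 \<in> lmeasurable"
        by (intro fmeasurable_Int_fmeasurable lmeasurable_ball) (simp add: open_coprime_approximable borel_open)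
      show "?U \<in> sets lebesgue" using finS by (intro sets.finite_UN) auto
      have "ball (p n) \<rho> \<subseteq> coprime_approximable \<alpha> \<epsilon> n0" if n: "n \<in> S" for n
      proof -
        have n1: "1 \<le> n" "n \<le> N" "n0 \<le> n" using n by (auto simp: S_def coprime_visits_def)
        \<comment> \<open>The radius allowed at time \<open>n \<le> N\<close> is at least the one
          allowed at \<open>N\<close>.\<close>
        have "real N powr (- 1 / real ?d) \<le> real n powr (- 1 / real ?d)"
          using n1 by (intro powr_mono2') auto
        then have "\<rho> \<le> \<epsilon> * real n powr (- 1 / real ?d)"
          unfolding \<rho>_def using e by (intro mult_mono) auto
        then have "ball (p n) \<rho> \<subseteq> ball (p n) (\<epsilon> * real n powr (- 1 / real ?d))" by (rule subset_ball)
        then show ?thesis unfolding coprime_approximable_def using n1 m(1)[OF n] unfolding p_def by blast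
      qed
      moreover have "ball (p n) \<rho> \<subseteq> ball a ((real ?d + 1) / real M)" if n: "n \<in> S" for n
      proof -
        \<comment> \<open>The centre lies within \<open>d/M\<close> of \<open>a\<close>, each
          coordinate contributing at most \<open>1/M\<close>; \<open>\<rho>\<close> adds another
          \<open>1/M\<close>, whence the radius \<open>(d + 1) / M\<close>.\<close>
        have "norm (p n - a) \<le> (\<Sum>i\<in>UNIV. \<bar>(p n - a) $ i\<bar>)" by (rule norm_le_l1_cart)
        also have "\<dots> \<le> (\<Sum>i\<in>(UNIV :: 'd set). 1 / real M)"
        proof (rule sum_mono)
          fix i
          have "a $ i \<le> p n $ i" "p n $ i < a $ i + 1 / real M"
            using m(2)[OF n] unfolding p_def[symmetric] Q_def half_open_cube_def by auto
          then show "\<bar>(p n - a) $ i\<bar> \<le> 1 / real M" by simp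
        qed
        finally have 1: "dist a (p n) \<le> real ?d / real M" by (simp add: dist_norm norm_minus_commute)
        have "real M = (real M ^ ?d) powr (1 / real ?d)"
          using M2 by (simp add: powr_realpow[symmetric] powr_powr)
        also have "\<dots> \<le> real N powr (1 / real ?d)"
          using N(3) by (intro powr_mono2) (auto simp flip: of_nat_power)
        finally have "1 / real N powr (1 / real ?d) \<le> 1 / real M"
          using M2 N(1) by (intro divide_left_mono) auto
        then have "real N powr (- 1 / real ?d) \<le> 1 / real M" by (simp add: powr_minus_divide)
        then have 2: "\<rho> \<le> 1 / real M"
          using mult_mono[OF e(3), of "real N powr (- 1 / real ?d)" "1 / real M"] by (simp add: \<rho>_def)
        show ?thesis
        proof
          fix x assume "x \<in> ball (p n) \<rho>"
          then have "dist a x < real ?d / real M + 1 / real M"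
            using dist_triangle[of a x "p n"] 1 2 by simp
          then show "x \<in> ball a ((real ?d + 1) / real M)" by (simp add: add_divide_distrib)
        qed
      qed
      ultimately show "?U \<subseteq> ball a ((real ?d + 1) / real M) \<inter> coprime_approximable \<alpha> \<epsilon> n0"
        by blast
    qed
    ultimately show ?thesis by linarith
  qed
  show ?thesis unfolding Let_def using \<open>\<delta> > 0\<close> main by blast
qed

text \<open>The radii \<open>(d + 1) / M\<close> tend to 0 with a density that does not deteriorate,
  so the complement misses a fixed fraction of arbitrarily small balls around each point.\<close>

lemma negligible_not_coprime_approximable:
  fixes \<alpha> :: "real ^ 'd"
  assumes \<alpha>: "\<alpha> \<in> nonsingular_frequencies" and d: "CARD('d) \<ge> 2" and \<epsilon>: "0 < \<epsilon>" "\<epsilon> \<le> 1"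
  shows "negligible (- coprime_approximable \<alpha> \<epsilon> n0)"
proof -
  obtain \<delta> M0 where "\<delta> > 0" and M0: "\<And>M x. M \<ge> M0 \<Longrightarrow>
     \<delta> * measure lebesgue (ball x ((real CARD('d) + 1) / real M))
     \<le> measure lebesgue (ball x ((real CARD('d) + 1) / real M) \<inter> coprime_approximable \<alpha> \<epsilon> n0)"
    using measure_coprime_approximable_ge[OF assms] unfolding Let_def by blast
  show ?thesis
  proof (rule negligible_if_complement_density_ge)
    show "- coprime_approximable \<alpha> \<epsilon> n0 \<in> sets lebesgue"
    proof -
      have "closed (- coprime_approximable \<alpha> \<epsilon> n0)"
        by (simp add: closed_Compl open_coprime_approximable)
      then show ?thesis by (simp add: borel_closed)
    qed
    fix x :: "real ^ 'd" and r :: real assume "r > 0"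
    obtain M :: nat where M: "(real CARD('d) + 1) / r < real M" using reals_Archimedean2 by blast
    define M' where "M' = max M M0"
    have "0 < (real CARD('d) + 1) / r" using \<open>r > 0\<close> by simp
    then have "real M' > 0" "(real CARD('d) + 1) / r < real M'" using M by (auto simp: M'_def)
    then have "0 < (real CARD('d) + 1) / real M'" "(real CARD('d) + 1) / real M' < r"
      using \<open>r > 0\<close> by (simp_all add: field_simps)
    then show "\<exists>d. 0 < d \<and> d < r \<and> \<delta> * measure lebesgue (ball x d)
        \<le> measure lebesgue (ball x d - - coprime_approximable \<alpha> \<epsilon> n0)"
      using M0[of M' x] by (intro exI[of _ "(real CARD('d) + 1) / real M'"]) (simp add: M'_def Diff_eq)
  qed fact
qed

section \<open>From approximable points to the lower limit\<close>

lemma coprime_approximable_imp: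
  fixes \<alpha> \<gamma> :: "real ^ 'd"
  assumes "\<gamma> \<in> coprime_approximable \<alpha> \<epsilon> n0"
  shows "\<exists>n\<ge>n0. real n powr (1 / real CARD('d)) * coprime_min_dist \<gamma> \<alpha> n < \<epsilon>"
proof -
  obtain n m where n: "n \<ge> n0" and m: "m \<in> coprime_lattice n"
    and dist: "dist (real n *\<^sub>R \<alpha> - real_vec m) \<gamma> < \<epsilon> * real n powr (- 1 / real CARD('d))"
    using assms by (auto simp: coprime_approximable_def)
  \<comment> \<open>At \<open>n = 0\<close> the radius is 0, because \<open>0 powr x = 0\<close>,
    and the ball is empty.\<close>
  have n0: "n > 0" using dist by (cases "n = 0") auto
  have "coprime_min_dist \<gamma> \<alpha> n \<le> infnorm (\<gamma> - real n *\<^sub>R \<alpha> + real_vec m)"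
    using coprime_min_dist_attained[of n \<gamma> \<alpha>] m by auto
  also have "\<dots> \<le> norm (\<gamma> - real n *\<^sub>R \<alpha> + real_vec m)" by (rule infnorm_le_norm)
  also have "\<dots> = dist (real n *\<^sub>R \<alpha> - real_vec m) \<gamma>"
    by (simp add: dist_norm norm_minus_commute algebra_simps)
  also note dist
  finally have "coprime_min_dist \<gamma> \<alpha> n < \<epsilon> / real n powr (1 / real CARD('d))"
    by (simp add: powr_minus_divide)
  then show ?thesis using n n0 by (auto simp: field_simps intro!: exI[of _ n])
qed

lemma coprime_min_dist_nonneg: "coprime_min_dist \<gamma> \<alpha> n \<ge> 0"
  using coprime_min_dist_attained[of n \<gamma> \<alpha>] infnorm_pos_le by auto

theorem theorem1p1:
  fixes \<alpha> :: "real ^ 'd"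
  assumes "CARD('d) \<ge> 2"
    and "\<alpha> \<in> nonsingular_frequencies"
  shows "AE \<gamma> in lebesgue.
           liminf (\<lambda>n. ereal (real n powr (1 / real CARD('d)) * coprime_min_dist \<gamma> \<alpha> n)) = 0"
proof -
  \<comment> \<open>The radii \<open>1 / Suc k\<close> and thresholds \<open>n0\<close> form a
    countable family, so the exceptional null sets can be united.\<close>
  have "AE \<gamma> in lebesgue. \<gamma> \<in> coprime_approximable \<alpha> (1 / real (Suc k)) n0" for k n0
  proof -
    have "- coprime_approximable \<alpha> (1 / real (Suc k)) n0 \<in> null_sets lebesgue"
      using negligible_not_coprime_approximable[OF assms(2,1), of "1 / real (Suc k)" n0]
      by (simp add: negligible_iff_null_sets)
    from AE_not_in[OF this] show ?thesis by (rule AE_mp) (rule AE_I2, simp)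
  qed
  then have "AE \<gamma> in lebesgue. \<forall>k n0. \<gamma> \<in> coprime_approximable \<alpha> (1 / real (Suc k)) n0"
    unfolding AE_all_countable by blast
  then show ?thesis
  proof (rule AE_mp, intro AE_I2 impI)
    fix \<gamma> :: "real ^ 'd"
    assume \<gamma>: "\<forall>k n0. \<gamma> \<in> coprime_approximable \<alpha> (1 / real (Suc k)) n0"
    let ?f = "\<lambda>n. real n powr (1 / real CARD('d)) * coprime_min_dist \<gamma> \<alpha> n"
    have "0 \<le> liminf (\<lambda>n. ereal (?f n))"
      by (rule Liminf_bounded) (simp add: coprime_min_dist_nonneg)
    moreover have "liminf (\<lambda>n. ereal (?f n)) \<le> 0"
    proof (rule leI, rule notI)
      assume "0 < liminf (\<lambda>n. ereal (?f n))"
      \<comment> \<open>Eventually all terms exceed this \<open>e\<close>, against the terms below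
        \<open>1 / Suc k < e\<close> at arbitrarily large \<open>n\<close>.\<close>
      then obtain e where "0 < ereal e" and e: "ereal e < liminf (\<lambda>n. ereal (?f n))"
        using ereal_dense2 by blast
      then have "e > 0" by simp
      from less_LiminfD[OF e] obtain n0 where n0: "\<And>n. n \<ge> n0 \<Longrightarrow> e < ?f n"
        by (auto simp: eventually_sequentially)
      obtain k where "1 / real (Suc k) < e" by (rule nat_approx_posE[OF \<open>e > 0\<close>])
      moreover obtain n where "n \<ge> n0" "?f n < 1 / real (Suc k)"
        using coprime_approximable_imp[OF \<gamma>[rule_format, of k n0]] by blast
      ultimately show False using n0[of n] by linarith
    qed
    ultimately show "liminf (\<lambda>n. ereal (?f n)) = 0" by (rule antisym[rotated])
  qed
qed

end
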